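(* Fix $k\in\mathbb{Z}_{\geq 1}$ and a set of patterns $B\subseteq\mathcal S$. Then the feasible region $P^{\mathrm{Av}(B)}_k$ is a closed subset of $[0,1]^{\mathcal S_k}$ and $$P^{\mathrm{Av}(B)}_k\subseteq P(\mathcal{O}v(k,\mathrm{Av}(B)))\subseteq P_k .$$ Moreover, if $\mathrm{Av}(B)$ is closed under the operation $\oplus$ or closed under the operation $\ominus$, then $P^{\mathrm{Av}(B)}_k$ is convex and $\dim(P^{\mathrm{Av}(B)}_k)\leq |\mathrm{Av}_k(B)|-|\mathrm{Av}_{k-1}(B)|$. In particular, for every single pattern $\tau\in\mathcal S$, $P^{\mathrm{Av}(\tau)}_k$ is convex.
   Context: For $n\ge1$, $\mathcal S_n$ is the set of permutations of $[n]=\{1,\dots,n\}$ in one-line notation, $\mathcal S=\bigcup_{n\ge1}\mathcal S_n$; by convention $\mathcal S_0$ and $\mathrm{Av}_0(B)$ consist of the empty permutation. For distinct reals $x_1,\dots,x_m$, $\mathrm{std}(x_1,\dots,x_m)$ is the unique $\pi\in\mathcal S_m$ with $\pi(i)<\pi(j)\iff x_i<x_j$. For $\sigma\in\mathcal S_n$ and $I=\{i_1<\dots<i_m\}\subseteq[n]$, $\mathrm{pat}_I(\sigma)=\mathrm{std}(\sigma(i_1),\dots,\sigma(i_m))$. A permutation $\sigma$ contains $\pi$ if $\mathrm{pat}_I(\sigma)=\pi$ for some $I$, and avoids $\pi$ otherwise. For $B\subseteq\mathcal S$, $\mathrm{Av}_n(B)$ is the set of permutations of size $n$ avoiding every element of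 $B$, and $\mathrm{Av}(B)=\bigcup_{n\ge1}\mathrm{Av}_n(B)$; $\mathrm{Av}(\tau)=\mathrm{Av}(\{\tau\})$. For $\pi\in\mathcal S_k$, $\sigma\in\mathcal S_n$, $\mathrm{c\text{-}occ}(\pi,\sigma)$ is the number of intervals $I=\{i,i+1,\dots,i+k-1\}\subseteq[n]$ with $\mathrm{pat}_I(\sigma)=\pi$, and $\widetilde{\mathrm{c\text{-}occ}}(\pi,\sigma)=\mathrm{c\text{-}occ}(\pi,\sigma)/n$. Feasible region: $P^{\mathrm{Av}(B)}_k$ is the set of $\vec v\in[0,1]^{\mathcal S_k}$ for which there is a sequence $(\sigma^m)_{m\ge1}$ in $\mathrm{Av}(B)$ with $|\sigma^m|\to\infty$ and $\widetilde{\mathrm{c\text{-}occ}}(\pi,\sigma^m)\to\vec v_\pi$ for all $\pi\in\mathcal S_k$; $P_k$ denotes this set when $B=\emptyset$ (all permutations allowed). Graphs are directed multigraphs (loops and parallel edges allowed); $\mathrm{st}(e),\mathrm{ar}(e)$ denote start and arrival vertex of edge $e$. A walk is a sequence of edges $(e_1,\dots,e_m)$ with $\mathrm{ar}(e_i)=\mathrm{st}(e_{i+1})$; it is a cycle if $\mathrm{st}(e_1)=\mathrm{ar}(e_m)$, and a simple cycle if moreover its edges are distinct and the vertices $\mathrm{st}(e_1),\dots,\mathrm{st}(e_m)$ are distinct. For a nonempty cycle $\mathcal C$ of $G=(V,E)$, $\vec e_{\mathcal C}\in\mathbb R^E$ has $e$-coordinate equal to (number of occurrences of $e$ in $\mathcal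 C$)$/|\mathcal C|$. The cycle polytope is $P(G)=\mathrm{conv}\{\vec e_{\mathcal C}:\mathcal C\text{ a simple cycle of }G\}$. Overlap graph: $\mathcal{O}v(k,\mathrm{Av}(B))$ has vertex set $\mathrm{Av}_{k-1}(B)$ and, for each $\pi\in\mathrm{Av}_k(B)$, one edge labelled $\pi$ from $\mathrm{pat}_{\{1,\dots,k-1\}}(\pi)$ to $\mathrm{pat}_{\{2,\dots,k\}}(\pi)$. Since its edges are in bijection with $\mathrm{Av}_k(B)$, its cycle polytope lies in $\mathbb R^{\mathrm{Av}_k(B)}$, which is identified with the subspace of $\mathbb R^{\mathcal S_k}$ of vectors vanishing outside $\mathrm{Av}_k(B)$. Direct sum: for $\tau\in\mathcal S_m,\sigma\in\mathcal S_n$, $\tau\oplus\sigma=\tau(1)\cdots\tau(m)(\sigma(1)+m)\cdots(\sigma(n)+m)$; skew sum $\tau\ominus\sigma=(\tau(1)+n)\cdots(\tau(m)+n)\sigma(1)\cdots\sigma(n)$. $\mathrm{Av}(B)$ is closed under $\oplus$ if $\tau,\sigma\in\mathrm{Av}(B)$ implies $\tau\oplus\sigma\in\mathrm{Av}(B)$ (similarly for $\ominus$). The dimension of a convex set is the dimension of its affine hull. *)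

theory Defs
  imports "HOL-Analysis.Analysis" "HOL-Library.Function_Algebras"
begin

instantiation "fun" :: (type, real_vector) real_vector
begin
definition scaleR_fun_def: "scaleR r f = (\<lambda>x. scaleR r (f x))"
instance
  by standard (simp_all add: scaleR_fun_def plus_fun_def fun_eq_iff scaleR_add_right scaleR_add_left)
end

definition affine_dim :: "('a::real_vector) set \<Rightarrow> int" where
  "affine_dim S = (if S = {} then -1
     else int (dim {x - y | x y. x \<in> affine hull S \<and> y \<in> affine hull S}))"

definition perms :: "nat \<Rightarrow> nat list set" where
  "perms n = {p. length p = n \<and> distinct p \<and> set p = {1..n}}"

definition all_perms :: "nat list set" where
  "all_perms = (\<Union>n\<in>{1..}. perms n)"

definition std :: "('a::linorder) list \<Rightarrow> nat list" where
  "std xs = map (\<lambda>x. card {y \<in> set xs. y \<le> x}) xs"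

definition pat :: "nat set \<Rightarrow> nat list \<Rightarrow> nat list" where
  "pat I \<sigma> = std (map (\<lambda>i. \<sigma> ! (i - 1)) (sorted_list_of_set I))"

definition contains :: "nat list \<Rightarrow> nat list \<Rightarrow> bool" where
  "contains \<sigma> \<pi> \<longleftrightarrow> (\<exists>I \<subseteq> {1..length \<sigma>}. pat I \<sigma> = \<pi>)"

definition Av_n :: "nat \<Rightarrow> nat list set \<Rightarrow> nat list set" where
  "Av_n n B = {\<sigma> \<in> perms n. \<forall>\<beta>\<in>B. \<not> contains \<sigma> \<beta>}"

definition Av :: "nat list set \<Rightarrow> nat list set" where
  "Av B = (\<Union>n\<in>{1..}. Av_n n B)"

definition cocc :: "nat list \<Rightarrow> nat list \<Rightarrow> nat" where
  "cocc \<pi> \<sigma> = card {i. 1 \<le> i \<and> i + length \<pi> - 1 \<le> length \<sigma>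
                       \<and> pat {i..i + length \<pi> - 1} \<sigma> = \<pi>}"

definition cocc_prop :: "nat list \<Rightarrow> nat list \<Rightarrow> real" where
  "cocc_prop \<pi> \<sigma> = real (cocc \<pi> \<sigma>) / real (length \<sigma>)"

text \<open>[0,1]^{S_k}, identified with functions vanishing outside S_k.\<close>
definition cube :: "nat \<Rightarrow> (nat list \<Rightarrow> real) set" where
  "cube k = {v. (\<forall>\<pi>\<in>perms k. 0 \<le> v \<pi> \<and> v \<pi> \<le> 1) \<and> (\<forall>\<pi>. \<pi> \<notin> perms k \<longrightarrow> v \<pi> = 0)}"

definition feasible :: "nat \<Rightarrow> nat list set \<Rightarrow> (nat list \<Rightarrow> real) set" where
  "feasible k B = {v \<in> cube k. \<exists>\<sigma> :: nat \<Rightarrow> nat list.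
      (\<forall>m. \<sigma> m \<in> Av B) \<and> filterlim (\<lambda>m. length (\<sigma> m)) at_top sequentially \<and>
      (\<forall>\<pi>\<in>perms k. (\<lambda>m. cocc_prop \<pi> (\<sigma> m)) \<longlonglongrightarrow> v \<pi>)}"

text \<open>A multigraph is given by its edge set E and start/arrival maps st, ar.
  Walks are lists of edges.\<close>
definition walk :: "'e set \<Rightarrow> ('e \<Rightarrow> 'v) \<Rightarrow> ('e \<Rightarrow> 'v) \<Rightarrow> 'e list \<Rightarrow> bool" where
  "walk E st ar es \<longleftrightarrow> set es \<subseteq> E \<and> (\<forall>i. Suc i < length es \<longrightarrow> ar (es ! i) = st (es ! Suc i))"

definition cycle :: "'e set \<Rightarrow> ('e \<Rightarrow> 'v) \<Rightarrow> ('e \<Rightarrow> 'v) \<Rightarrow> 'e list \<Rightarrow> bool" where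
  "cycle E st ar es \<longleftrightarrow> es \<noteq> [] \<and> walk E st ar es \<and> st (hd es) = ar (last es)"

definition simple_cycle :: "'e set \<Rightarrow> ('e \<Rightarrow> 'v) \<Rightarrow> ('e \<Rightarrow> 'v) \<Rightarrow> 'e list \<Rightarrow> bool" where
  "simple_cycle E st ar es \<longleftrightarrow> cycle E st ar es \<and> distinct es \<and> distinct (map st es)"

definition cycle_vec :: "'e list \<Rightarrow> ('e \<Rightarrow> real)" where
  "cycle_vec es = (\<lambda>e. real (count_list es e) / real (length es))"

definition cycle_polytope :: "'e set \<Rightarrow> ('e \<Rightarrow> 'v) \<Rightarrow> ('e \<Rightarrow> 'v) \<Rightarrow> ('e \<Rightarrow> real) set" where
  "cycle_polytope E st ar = convex hull {cycle_vec C | C. simple_cycle E st ar C}"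

text \<open>Overlap graph Ov(k, Av(B)): vertices Av_{k-1}(B), one edge pi for each pi in Av_k(B),
  from pat_{1..k-1}(pi) to pat_{2..k}(pi).\<close>
definition overlap_polytope :: "nat \<Rightarrow> nat list set \<Rightarrow> (nat list \<Rightarrow> real) set" where
  "overlap_polytope k B = cycle_polytope (Av_n k B) (\<lambda>\<pi>. pat {1..k-1} \<pi>) (\<lambda>\<pi>. pat {2..k} \<pi>)"

definition dsum :: "nat list \<Rightarrow> nat list \<Rightarrow> nat list" where
  "dsum \<tau> \<sigma> = \<tau> @ map (\<lambda>x. x + length \<tau>) \<sigma>"

definition ssum :: "nat list \<Rightarrow> nat list \<Rightarrow> nat list" where
  "ssum \<tau> \<sigma> = map (\<lambda>x. x + length \<sigma>) \<tau> @ \<sigma>"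

definition closed_dsum :: "nat list set \<Rightarrow> bool" where
  "closed_dsum B \<longleftrightarrow> (\<forall>\<tau>\<in>Av B. \<forall>\<sigma>\<in>Av B. dsum \<tau> \<sigma> \<in> Av B)"

definition closed_ssum :: "nat list set \<Rightarrow> bool" where
  "closed_ssum B \<longleftrightarrow> (\<forall>\<tau>\<in>Av B. \<forall>\<sigma>\<in>Av B. ssum \<tau> \<sigma> \<in> Av B)"

end

theory Submission
  imports Defs "HOL-Library.Sublist"
begin

text \<open>
  Counting the consecutive patterns of a permutation by their first (or last) k - 1 entries counts
  its windows of length k - 1, up to one window at either end. In the limit a feasible vector is
  therefore a nonnegative circulation of total mass 1 on the overlap graph, and such a circulation
  is a convex combination of simple cycles. Conversely, every walk in the full overlap graph is the
  sequence of windows of some sequence of reals, built by appending one value at a time; repeating a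
  simple cycle gives its vector in the limit.

  A direct or skew sum adds occurrence counts up to at most k occurrences across the seam. Sums of
  many copies of two permutations thus realise every convex combination. Closure under a sum also
  makes the overlap graph strongly connected, so the circulations of total mass 0 have dimension at
  most |E| - |V|.

  A pattern that occurs across the seam of a direct sum has its first entry below its last one, for a
  skew sum it is above; so a class avoiding one pattern is closed under one of the two sums.
\<close>

section \<open>Standardization and consecutive windows\<close>

text \<open>On a strongly connected graph the conservation laws have rank one less than the number
  of vertices; the mass condition supplies the missing one. No rank is computed: every vertex
  selects one outgoing edge on the way to a root, and a circulation of mass 0 carried by the
  selected edges alone vanishes. The \<open>card E - card V\<close> remaining coordinates therefore
  determine it.

  Walks are realized over the reals because a new value then fits between old ones without
  relabelling anything. Only entries at distance less than k are controlled, so nothing keeps the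
  resulting permutation inside the class; this is why the second inclusion ends in the unrestricted
  region.

  Frequencies are relative to length, so mixing two permutations in a given proportion means
  balancing the total lengths of their copies, not the numbers of copies. Seams cost a bounded
  amount per summand, which becomes negligible only because the summands themselves are
  long.\<close>

lemma strict_mono_on_card_le:
  fixes xs :: "'a::linorder list"
  shows "strict_mono_on (set xs) (\<lambda>x. card {y \<in> set xs. y \<le> x})"
proof (rule strict_mono_onI)
  fix r s assume *: "r \<in> set xs" "s \<in> set xs" "r < s"
  then have "{y \<in> set xs. y \<le> r} \<subset> {y \<in> set xs. y \<le> s}" by force
  then show "card {y \<in> set xs. y \<le> r} < card {y \<in> set xs. y \<le> s}"
    by (intro psubset_card_mono) auto
qed

lemma length_std [simp]: "length (std xs) = length xs"
  by (simp add: std_def)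

lemma std_map:
  fixes f :: "'a::linorder \<Rightarrow> 'b::linorder"
  assumes "strict_mono_on (set xs) f"
  shows "std (map f xs) = std xs"
proof -
  have inj: "inj_on f (set xs)"
    using assms by (rule strict_mono_on_imp_inj_on)
  have "card {y \<in> f ` set xs. y \<le> f x} = card {y \<in> set xs. y \<le> x}" if "x \<in> set xs" for x
  proof -
    have "{y \<in> f ` set xs. y \<le> f x} = f ` {y \<in> set xs. y \<le> x}"
      using that strict_mono_on_leD[OF assms] strict_mono_onD[OF assms]
      by (auto simp: linorder_not_less[symmetric])
    then show ?thesis
      using inj by (simp add: card_image inj_on_subset)
  qed
  then show ?thesis
    by (simp add: std_def)
qed

lemma std_map_add [simp]: "std (map (\<lambda>x. x + a) xs) = std (xs :: nat list)"
  by (intro std_map) (simp add: strict_mono_on_def)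

text \<open>Ranks within the larger list preserve the order of its members, so patterns can be read
  off before or after standardizing the whole. Windows and pattern containment both rest on
  this.\<close>

lemma std_subset_std:
  fixes xs ys :: "'a::linorder list"
  assumes "set ys \<subseteq> set xs"
  shows "std (map (\<lambda>x. card {y \<in> set xs. y \<le> x}) ys) = std ys"
  using monotone_on_subset[OF strict_mono_on_card_le assms] by (rule std_map)

lemma std_nth_le_iff:
  assumes "i < length xs" "j < length xs"
  shows "std xs ! i \<le> std xs ! j \<longleftrightarrow> xs ! i \<le> xs ! j"
  using strict_mono_on_less_eq[OF strict_mono_on_card_le, of "xs ! i" xs "xs ! j"] assms
  by (simp add: std_def)

lemma std_nth_less_iff:
  assumes "i < length xs" "j < length xs"
  shows "std xs ! i < std xs ! j \<longleftrightarrow> xs ! i < xs ! j"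
  using std_nth_le_iff[OF assms(2,1)] by (simp add: linorder_not_le[symmetric])

lemma std_nth:
  assumes "distinct xs" "i < length xs"
  shows "std xs ! i = card {j. j < length xs \<and> xs ! j \<le> xs ! i}"
proof -
  have "{y \<in> set xs. y \<le> xs ! i} = (!) xs ` {j. j < length xs \<and> xs ! j \<le> xs ! i}"
    by (auto simp: in_set_conv_nth)
  moreover have "inj_on ((!) xs) {j. j < length xs \<and> xs ! j \<le> xs ! i}"
    using assms(1) by (auto simp: inj_on_def nth_eq_iff_index_eq)
  ultimately show ?thesis
    using assms(2) by (simp add: std_def card_image)
qed

lemma std_eqI:
  fixes xs :: "'a::linorder list" and ys :: "'b::linorder list"
  assumes "distinct xs" "distinct ys" "length xs = length ys"
    and "\<And>i j. i < length xs \<Longrightarrow> j < length xs \<Longrightarrow> xs ! i \<le> xs ! j \<longleftrightarrow> ys ! i \<le> ys ! j"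
  shows "std xs = std ys"
proof (rule nth_equalityI)
  fix i assume "i < length (std xs)"
  moreover from this have "{j. j < length xs \<and> xs ! j \<le> xs ! i} = {j. j < length ys \<and> ys ! j \<le> ys ! i}"
    using assms by auto
  ultimately show "std xs ! i = std ys ! i"
    using assms by (simp add: std_nth)
qed (simp add: assms)

lemma std_perms: "p \<in> perms n \<Longrightarrow> std p = p"
proof -
  assume p: "p \<in> perms n"
  have "card {y \<in> set p. y \<le> x} = x" if "x \<in> set p" for x
  proof -
    have "{y \<in> set p. y \<le> x} = {1..x}" using p that by (auto simp: perms_def)
    then show ?thesis by simp
  qed
  then show ?thesis by (simp add: std_def map_idI)
qed

lemma std_in_perms:
  fixes xs :: "'a::linorder list"
  assumes "distinct xs"
  shows "std xs \<in> perms (length xs)"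
proof -
  have d: "distinct (std xs)"
    unfolding std_def distinct_map
    using assms strict_mono_on_imp_inj_on[OF strict_mono_on_card_le] by blast
  have "set (std xs) \<subseteq> {1..length xs}"
  proof
    fix n assume "n \<in> set (std xs)"
    then obtain x where x: "x \<in> set xs" "n = card {y \<in> set xs. y \<le> x}"
      by (auto simp: std_def)
    have "card {y \<in> set xs. y \<le> x} \<le> card (set xs)" by (intro card_mono) auto
    moreover have "card {y \<in> set xs. y \<le> x} > 0" using x by (auto simp: card_gt_0_iff)
    ultimately show "n \<in> {1..length xs}"
      using x card_length[of xs] by auto
  qed
  moreover have "card (set (std xs)) = card {1..length xs}"
    using distinct_card[OF d] by simp
  ultimately have "set (std xs) = {1..length xs}"
    by (simp add: card_subset_eq)
  with d show ?thesis by (simp add: perms_def)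
qed

lemma finite_perms: "finite (perms n)"
proof (rule finite_subset)
  show "perms n \<subseteq> {xs. set xs \<subseteq> {1..n} \<and> length xs = n}" by (auto simp: perms_def)
qed (simp add: finite_lists_length_eq)

text \<open>Offsets start at 0, whereas \<open>pat\<close> counts positions from 1. The entry type
  is left open because windows are also taken of lists of reals.\<close>

definition win :: "nat \<Rightarrow> nat \<Rightarrow> 'a::linorder list \<Rightarrow> nat list" where
  "win k i xs = std (take k (drop i xs))"

lemma win_std:
  fixes xs :: "'a::linorder list"
  shows "win k i (std xs) = win k i xs"
proof -
  have "set (take k (drop i xs)) \<subseteq> set xs"
    by (meson in_set_takeD in_set_dropD subsetI)
  from std_subset_std[OF this] show ?thesis
    unfolding win_def by (simp add: std_def[of xs] take_map drop_map)
qed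

lemma win_win:
  assumes "i + m \<le> n"
  shows "win m i (win n j xs) = win m (i + j) xs"
proof -
  have "win m i (win n j xs) = win m i (take n (drop j xs))"
    using win_std[of m i "take n (drop j xs)"] by (simp add: win_def)
  also have "\<dots> = win m (i + j) xs"
    using assms by (simp add: win_def drop_take add.commute)
  finally show ?thesis .
qed

text \<open>The half-open interval includes the empty window \<open>m = 0\<close>, which occurs as
  both endpoints of every edge when k = 1.\<close>

lemma pat_interval:
  assumes "i \<ge> 1" "i + m \<le> Suc (length \<sigma>)"
  shows "pat {i..<i + m} \<sigma> = win m (i - 1) \<sigma>"
proof -
  have "map (\<lambda>j. \<sigma> ! (j - 1)) [i..<i + m] = take m (drop (i - 1) \<sigma>)"
    using assms by (intro nth_equalityI) auto
  then show ?thesis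
    by (simp add: pat_def win_def)
qed

lemma pat_init: "length \<pi> = k \<Longrightarrow> k \<ge> 1 \<Longrightarrow> pat {1..k - 1} \<pi> = win (k - 1) 0 \<pi>"
  using pat_interval[of 1 "k - 1" \<pi>] by (simp flip: atLeastLessThanSuc_atLeastAtMost)

lemma pat_tail: "length \<pi> = k \<Longrightarrow> k \<ge> 1 \<Longrightarrow> pat {2..k} \<pi> = win (k - 1) 1 \<pi>"
  using pat_interval[of 2 "k - 1" \<pi>] by (simp flip: atLeastLessThanSuc_atLeastAtMost)

lemma cocc_eq_card_win:
  assumes "length \<pi> = k" "k \<ge> 1"
  shows "cocc \<pi> \<sigma> = card {i. i + k \<le> length \<sigma> \<and> win k i \<sigma> = \<pi>}"
proof -
  have *: "pat {i..i + k - 1} \<sigma> = win k (i - 1) \<sigma>" if "1 \<le> i" "i + k - 1 \<le> length \<sigma>" for i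
    using pat_interval[of i k \<sigma>] that assms by (simp flip: atLeastLessThanSuc_atLeastAtMost)
  have "{i. 1 \<le> i \<and> i + length \<pi> - 1 \<le> length \<sigma> \<and> pat {i..i + length \<pi> - 1} \<sigma> = \<pi>}
    = Suc ` {i. i + k \<le> length \<sigma> \<and> win k i \<sigma> = \<pi>}" (is "?A = Suc ` ?B")
  proof (intro equalityI subsetI)
    fix i assume i: "i \<in> ?A"
    then have "i - 1 \<in> ?B" using *[of i] assms by auto
    moreover have "i = Suc (i - 1)" using i by simp
    ultimately show "i \<in> Suc ` ?B" by blast
  next
    fix i assume "i \<in> Suc ` ?B"
    then obtain j where "i = Suc j" "j \<in> ?B" by blast
    then show "i \<in> ?A" using *[of i] assms by simp
  qed
  then show ?thesis
    unfolding cocc_def by (simp add: card_image)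
qed

section \<open>Pattern containment through subsequences\<close>

lemma pat_eq_std_nths:
  assumes "I \<subseteq> {1..length \<sigma>}"
  shows "pat I \<sigma> = std (nths \<sigma> {i. Suc i \<in> I})"
proof -
  have fin: "finite I" using assms finite_subset by blast
  have "sorted_list_of_set I = filter (\<lambda>i. i \<in> I) [1..<Suc (length \<sigma>)]"
    using assms fin by (intro sorted_distinct_set_unique) (auto simp: sorted_filter[where f = id, simplified] simp del: upt_Suc)
  also have "\<dots> = map Suc (filter (\<lambda>i. Suc i \<in> I) [0..<length \<sigma>])"
    unfolding One_nat_def map_Suc_upt[symmetric] by (simp add: filter_map comp_def)
  finally have "map (\<lambda>i. \<sigma> ! (i - 1)) (sorted_list_of_set I)
    = map ((!) \<sigma>) (filter (\<lambda>i. Suc i \<in> I) [0..<length \<sigma>])"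
    by simp
  also have "\<dots> = nths \<sigma> {i. Suc i \<in> I}"
  proof -
    have "zip \<sigma> [0..<length \<sigma>] = map (\<lambda>i. (\<sigma> ! i, i)) [0..<length \<sigma>]"
      by (intro nth_equalityI) auto
    then show ?thesis by (simp add: nths_def filter_map comp_def)
  qed
  finally show ?thesis by (simp add: pat_def)
qed

text \<open>Subsequences compose and split along an append, which index sets do only after
  renumbering. Heredity of the class uses the first property, occurrences in a sum use the
  second.\<close>

lemma contains_iff_subseq: "contains \<sigma> \<pi> \<longleftrightarrow> (\<exists>ys. subseq ys \<sigma> \<and> std ys = \<pi>)"
proof
  assume "contains \<sigma> \<pi>"
  then show "\<exists>ys. subseq ys \<sigma> \<and> std ys = \<pi>"
    unfolding contains_def using pat_eq_std_nths by (metis subseq_conv_nths)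
next
  assume "\<exists>ys. subseq ys \<sigma> \<and> std ys = \<pi>"
  then obtain N where N: "std (nths \<sigma> N) = \<pi>"
    by (auto simp: subseq_conv_nths)
  \<comment> \<open>\<open>N\<close> may reach beyond the end of the list; the intersection discards
    those indices and \<open>Suc\<close> passes to positions counted from 1.\<close>
  let ?I = "Suc ` (N \<inter> {..<length \<sigma>})"
  have "pat ?I \<sigma> = std (nths \<sigma> {i. Suc i \<in> ?I})"
    by (rule pat_eq_std_nths) auto
  also have "nths \<sigma> {i. Suc i \<in> ?I} = nths \<sigma> N"
    unfolding nths_def by (intro arg_cong[where f = "map fst"] filter_cong) (auto simp: set_zip)
  finally have "pat ?I \<sigma> = \<pi>"
    using N by simp
  then show "contains \<sigma> \<pi>"
    unfolding contains_def by (intro exI[of _ ?I]) auto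
qed

text \<open>Heredity: this is what keeps all windows of a member of the class inside the class,
  hence makes them edges and vertices of its overlap graph.\<close>

lemma contains_std_subseq:
  fixes \<sigma> zs :: "nat list"
  assumes "subseq zs \<sigma>" "contains (std zs) \<pi>"
  shows "contains \<sigma> \<pi>"
proof -
  let ?f = "\<lambda>x. card {y \<in> set zs. y \<le> x}"
  obtain ys where ys: "subseq ys (map ?f zs)" "std ys = \<pi>"
    using assms(2) unfolding contains_iff_subseq std_def[of zs] by blast
  then obtain N where "ys = map ?f (nths zs N)"
    by (auto simp: subseq_conv_nths nths_map)
  then have "std (nths zs N) = \<pi>"
    using ys(2) std_subset_std[OF set_nths_subset] by metis
  moreover have "subseq (nths zs N) \<sigma>"
    using assms(1) by (meson subseq_conv_nths subseq_order.trans)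
  ultimately show ?thesis
    unfolding contains_iff_subseq by blast
qed

lemma Av_nD: "\<sigma> \<in> Av_n n B \<Longrightarrow> length \<sigma> = n \<and> distinct \<sigma> \<and> \<sigma> \<in> perms n"
  by (auto simp: Av_n_def perms_def)

lemma finite_Av_n: "finite (Av_n n B)"
  by (rule finite_subset[OF _ finite_perms[of n]]) (auto simp: Av_n_def)

lemma Av_iff: "\<sigma> \<in> Av B \<longleftrightarrow> \<sigma> \<noteq> [] \<and> \<sigma> \<in> Av_n (length \<sigma>) B"
  unfolding Av_def using Av_nD by (fastforce simp: Suc_le_eq)

lemma win_in_Av_n:
  assumes "\<sigma> \<in> Av_n n B" "i + k \<le> n"
  shows "win k i \<sigma> \<in> Av_n k B"
proof -
  have "subseq (take k (drop i \<sigma>)) \<sigma>"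
    by (metis prefix_imp_subseq subseq_order.trans suffix_drop suffix_imp_subseq take_is_prefix)
  moreover have "win k i \<sigma> \<in> perms k"
    unfolding win_def using std_in_perms[of "take k (drop i \<sigma>)"] Av_nD[OF assms(1)] assms(2)
    by (simp add: min_absorb2)
  ultimately show ?thesis
    using assms(1) contains_std_subseq unfolding Av_n_def win_def by blast
qed

section \<open>Circulations on finite multigraphs\<close>

text \<open>Following successors forever must revisit a start vertex. Stopping at the least index
  \<open>j\<close> with a repetition guarantees that the vertices between the two visits are
  distinct.\<close>

lemma exists_simple_cycle:
  assumes "finite S" "S \<noteq> {}"
    and next_edge: "\<And>e. e \<in> S \<Longrightarrow> \<exists>e'\<in>S. st e' = ar e"
  shows "\<exists>C. simple_cycle S st ar C"
proof -
  obtain nxt where nxt: "\<And>e. e \<in> S \<Longrightarrow> nxt e \<in> S \<and> st (nxt e) = ar e"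
    using next_edge by metis
  obtain e0 where "e0 \<in> S" using assms(2) by blast
  define x where "x i = (nxt ^^ i) e0" for i :: nat
  have xS: "x i \<in> S" for i
    by (induction i) (auto simp: x_def \<open>e0 \<in> S\<close> nxt)
  have x_Suc: "st (x (Suc i)) = ar (x i)" for i
    using nxt[OF xS[of i]] by (simp add: x_def)
  have "\<not> inj (\<lambda>i. st (x i))"
  proof
    assume "inj (\<lambda>i. st (x i))"
    moreover have "finite (range (\<lambda>i. st (x i)))"
      using xS by (intro finite_subset[OF _ finite_imageI[OF assms(1), of st]]) auto
    ultimately show False
      using finite_imageD infinite_UNIV_nat by blast
  qed
  then have ex: "\<exists>j. \<exists>i<j. st (x i) = st (x j)"
    unfolding inj_def by (metis linorder_neqE_nat)
  define j where "j = (LEAST j. \<exists>i<j. st (x i) = st (x j))"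
  obtain i where i: "i < j" "st (x i) = st (x j)"
    using LeastI_ex[OF ex] unfolding j_def by blast
  have least: "st (x a) \<noteq> st (x b)" if "a < b" "b < j" for a b
    using not_less_Least[of b "\<lambda>j. \<exists>i<j. st (x i) = st (x j)"] that unfolding j_def by blast
  let ?C = "map x [i..<j]"
  have "distinct (map st ?C)"
    unfolding map_map distinct_map
    using least by (auto simp: inj_on_def) (metis linorder_neqE_nat)
  moreover from this have "distinct ?C" by (simp only: distinct_map)
  moreover have "walk S st ar ?C"
    using xS x_Suc by (auto simp: walk_def)
  moreover have "st (hd ?C) = ar (last ?C)"
  proof -
    obtain j' where j': "j = Suc j'" using i by (cases j) auto
    then have "last ?C = x j'" "hd ?C = x i"
      using i by (auto simp: hd_map simp del: upt_Suc) (simp add: last_map)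
    then show ?thesis using i x_Suc j' by simp
  qed
  ultimately show ?thesis
    unfolding simple_cycle_def cycle_def using i by (intro exI[of _ ?C]) auto
qed

text \<open>Circulations, with neither a sign nor a mass condition, so that they form a linear
  space. Conservation may be demanded at every \<open>x\<close> of the vertex type, since both sums
  are empty where no edge starts or arrives.\<close>

definition flow :: "'e set \<Rightarrow> ('e \<Rightarrow> 'v) \<Rightarrow> ('e \<Rightarrow> 'v) \<Rightarrow> ('e \<Rightarrow> real) \<Rightarrow> bool" where
  "flow E st ar f \<longleftrightarrow> (\<forall>e. e \<notin> E \<longrightarrow> f e = 0)
     \<and> (\<forall>x. (\<Sum>e | e \<in> E \<and> st e = x. f e) = (\<Sum>e | e \<in> E \<and> ar e = x. f e))"

lemma flow_lincomb:
  assumes "flow E st ar f" "flow E st ar g"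
  shows "flow E st ar (\<lambda>e. a * f e + b * g e)"
  using assms by (simp add: flow_def sum.distrib flip: sum_distrib_left)

lemma sum_count_list_fiber:
  assumes "finite E" "set C \<subseteq> E"
  shows "(\<Sum>e | e \<in> E \<and> h e = x. count_list C e) = count_list (map h C) x"
  using assms(2)
proof (induction C)
  case (Cons c C)
  have "(\<Sum>e | e \<in> E \<and> h e = x. count_list (c # C) e)
    = (\<Sum>e | e \<in> E \<and> h e = x. count_list C e) + (\<Sum>e | e \<in> E \<and> h e = x. if c = e then 1 else 0)"
    by (simp flip: sum.distrib) (intro sum.cong, auto)
  then show ?case
    using Cons assms(1) by (auto simp: sum.delta')
qed simp

text \<open>Rotation does not change multiplicities, so a cycle enters each vertex as often as it
  leaves it; this yields conservation in \<open>flow_cycle\<close>.\<close>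

lemma map_ar_cycle:
  assumes "cycle E st ar C"
  shows "map ar C = rotate1 (map st C)"
proof (rule nth_equalityI)
  fix i assume i: "i < length (map ar C)"
  show "map ar C ! i = rotate1 (map st C) ! i"
  proof (cases "Suc i < length C")
    case True
    then show ?thesis using assms by (simp add: nth_rotate1 cycle_def walk_def)
  next
    case False
    then have "Suc i = length C" using i by simp
    moreover from this have "last C = C ! i" by (metis assms cycle_def diff_Suc_1 last_conv_nth)
    moreover have "st (C ! 0) = ar (last C)"
      using assms by (metis cycle_def hd_conv_nth)
    moreover have "C \<noteq> []" using i by auto
    ultimately show ?thesis by (simp add: nth_rotate1)
  qed
qed simp

lemma flow_cycle:
  assumes "finite E" "cycle E st ar C"
  shows "flow E st ar (\<lambda>e. real (count_list C e))"
proof -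
  have C: "set C \<subseteq> E" using assms(2) by (simp add: cycle_def walk_def)
  have "count_list (rotate1 xs) x = count_list xs x" for xs :: "'b list" and x
    by (cases xs) auto
  then have "(\<Sum>e | e \<in> E \<and> st e = x. count_list C e) = (\<Sum>e | e \<in> E \<and> ar e = x. count_list C e)" for x
    using sum_count_list_fiber[OF assms(1) C] map_ar_cycle[OF assms(2)] by metis
  then have "(\<Sum>e | e \<in> E \<and> st e = x. real (count_list C e)) = (\<Sum>e | e \<in> E \<and> ar e = x. real (count_list C e))" for x
    by (simp flip: of_nat_sum)
  then show ?thesis
    using C by (auto simp: flow_def count_list_0_iff)
qed

text \<open>Subtracting the largest possible multiple of a simple cycle in the support makes the
  support smaller.\<close>

lemma flow_in_cycle_polytope:
  assumes "finite E"
  shows "flow E st ar f \<Longrightarrow> (\<And>e. 0 \<le> f e) \<Longrightarrow> 0 < sum f E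
    \<Longrightarrow> (\<lambda>e. f e / sum f E) \<in> cycle_polytope E st ar"
proof (induction "card {e \<in> E. 0 < f e}" arbitrary: f rule: less_induct)
  case less
  let ?S = "{e \<in> E. 0 < f e}"
  have pos: "0 < (\<Sum>e | e \<in> E \<and> h e = x. f e) \<longleftrightarrow> (\<exists>e\<in>?S. h e = x)" for h :: "'a \<Rightarrow> 'b" and x
  proof -
    have "finite {e \<in> E. h e = x}" using assms by simp
    from sum_nonneg_eq_0_iff[OF this, of f] less.prems(2)
    have "(\<Sum>e | e \<in> E \<and> h e = x. f e) = 0 \<longleftrightarrow> (\<forall>e\<in>{e \<in> E. h e = x}. f e = 0)" by simp
    moreover have "(\<Sum>e | e \<in> E \<and> h e = x. f e) \<ge> 0" using less.prems(2) by (simp add: sum_nonneg)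
    ultimately show ?thesis
      using less.prems(2) by (force simp: less_le)
  qed
  have "?S \<noteq> {}"
    using less.prems(3) less.prems(2) by (metis (mono_tags, lifting) empty_Collect_eq less_le sum_nonpos order_le_less linorder_not_less)
  \<comment> \<open>A positive edge into a vertex makes its inflow positive; by conservation so is
    its outflow, and some positive edge leaves it.\<close>
  moreover have "\<exists>e'\<in>?S. st e' = ar e" if "e \<in> ?S" for e
    using pos[of ar "ar e"] pos[of st "ar e"] that less.prems(1) by (auto simp: flow_def)
  ultimately obtain C where C: "simple_cycle ?S st ar C"
    using exists_simple_cycle[of ?S st ar] assms by auto
  then have CS: "set C \<subseteq> ?S" and C_ne: "C \<noteq> []" and dist: "distinct C"
    by (auto simp: simple_cycle_def cycle_def walk_def)
  have CE: "simple_cycle E st ar C"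
    using C by (auto simp: simple_cycle_def cycle_def walk_def)
  define m where "m = Min (f ` set C)"
  have m_le: "m \<le> f e" if "e \<in> set C" for e
    using that by (simp add: m_def)
  have "m \<in> f ` set C" using C_ne by (simp add: m_def)
  then obtain e0 where e0: "e0 \<in> set C" "f e0 = m" by blast
  have "m > 0" using e0 CS by auto
  \<comment> \<open>Each edge of \<open>C\<close> is used once, so subtracting \<open>m\<close>
    times the cycle lowers exactly the edges of \<open>C\<close>, each by \<open>m\<close>.\<close>
  have cnt: "count_list C e = (if e \<in> set C then 1 else 0)" for e
    using dist by (induction C) auto
  define g where "g = (\<lambda>e. 1 * f e + (- m) * real (count_list C e))"
  have g_flow: "flow E st ar g"
    unfolding g_def using less.prems(1) flow_cycle[OF assms] CE
    by (intro flow_lincomb) (auto simp: simple_cycle_def)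
  have g_nonneg: "0 \<le> g e" for e
    using m_le less.prems(2) by (simp add: g_def cnt)
  have "(\<Sum>e\<in>E. count_list C e) = length C"
    using sum_count_set[of C E] CS assms by auto
  then have sum_cnt: "(\<Sum>e\<in>E. real (count_list C e)) = real (length C)"
    by (simp flip: of_nat_sum)
  then have sum_g: "sum g E = sum f E - m * length C"
    by (simp add: g_def sum_subtractf sum_negf sum.distrib flip: sum_distrib_left)
  have C_in: "cycle_vec C \<in> cycle_polytope E st ar"
    unfolding cycle_polytope_def using CE by (intro hull_inc) blast
  show ?case
  proof (cases "sum g E = 0")
    case True
    then have "g e = 0" if "e \<in> E" for e
      using that g_nonneg assms by (simp add: sum_nonneg_eq_0_iff)
    then have "g e = 0" for e
      using g_flow by (auto simp: flow_def)
    then have "f e = m * real (count_list C e)" for e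
      by (simp add: g_def)
    moreover have "sum f E = m * length C" using True sum_g by simp
    ultimately have "(\<lambda>e. f e / sum f E) = cycle_vec C"
      using \<open>m > 0\<close> by (auto simp: cycle_vec_def fun_eq_iff)
    then show ?thesis using C_in by simp
  next
    case False
    then have g_pos: "sum g E > 0" using g_nonneg by (simp add: less_le sum_nonneg)
    have "{e \<in> E. 0 < g e} \<subset> ?S"
    proof
      have "e0 \<in> ?S" using e0 CS by auto
      moreover have "e0 \<notin> {e \<in> E. 0 < g e}" using e0 by (simp add: g_def cnt)
      ultimately show "{e \<in> E. 0 < g e} \<noteq> ?S" by blast
      show "{e \<in> E. 0 < g e} \<subseteq> ?S"
        using \<open>m > 0\<close> by (auto simp: g_def cnt split: if_splits)
    qed
    then have "card {e \<in> E. 0 < g e} < card ?S"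
      using assms by (intro psubset_card_mono) auto
    from less.hyps[OF this g_flow g_nonneg g_pos]
    have IH: "(\<lambda>e. g e / sum g E) \<in> cycle_polytope E st ar" .
    let ?c = "sum f E"
    have conv: "convex (cycle_polytope E st ar)"
      by (simp add: cycle_polytope_def)
    \<comment> \<open>Each part is weighted by its share of the mass; the two masses add up to
      \<open>sum f E\<close>.\<close>
    have "(sum g E / ?c) *\<^sub>R (\<lambda>e. g e / sum g E) + (m * length C / ?c) *\<^sub>R cycle_vec C
      \<in> cycle_polytope E st ar"
    proof (intro convexD[OF conv] IH C_in)
      show "sum g E / ?c + m * length C / ?c = 1"
        using sum_g less.prems(3) by (simp flip: add_divide_distrib)
    qed (use g_pos \<open>m > 0\<close> less.prems(3) in simp_all)
    also have "(sum g E / ?c) *\<^sub>R (\<lambda>e. g e / sum g E) + (m * length C / ?c) *\<^sub>R cycle_vec C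
      = (\<lambda>e. f e / ?c)"
    proof
      fix e
      have "((sum g E / ?c) *\<^sub>R (\<lambda>e. g e / sum g E) + (m * length C / ?c) *\<^sub>R cycle_vec C) e
        = g e / ?c + m * count_list C e / ?c"
        using g_pos C_ne by (simp add: scaleR_fun_def cycle_vec_def)
      also have "\<dots> = f e / ?c"
        by (simp add: g_def flip: add_divide_distrib)
      finally show "((sum g E / ?c) *\<^sub>R (\<lambda>e. g e / sum g E) + (m * length C / ?c) *\<^sub>R cycle_vec C) e
        = f e / ?c" .
    qed
    finally show ?thesis .
  qed
qed

section \<open>Dimension of the space of circulations\<close>

text \<open>Here \<open>g\<close> is a signed measure equal to its own image under \<open>N\<close>.
  The positive set has the same mass as its preimage, and the preimage cannot carry more than the
  positive points it contains. A positive point mapped outside would be a strict loss.\<close>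

lemma positive_set_invariant:
  fixes g :: "'v \<Rightarrow> real"
  assumes "finite V" "\<And>x. x \<in> V \<Longrightarrow> N x \<in> V"
    and g: "\<And>x. x \<in> V \<Longrightarrow> g x = (\<Sum>y | y \<in> V \<and> N y = x. g y)"
    and x: "x \<in> V" "g x > 0"
  shows "g (N x) > 0"
proof (rule ccontr)
  assume neg: "\<not> g (N x) > 0"
  let ?P = "{x \<in> V. g x > 0}"
  have fin: "finite ?P" using assms(1) by simp
  have "sum g ?P = (\<Sum>x\<in>?P. \<Sum>y | y \<in> {y \<in> V. N y \<in> ?P} \<and> N y = x. g y)"
    by (intro sum.cong refl) (subst g, auto intro!: sum.cong)
  also have "\<dots> = (\<Sum>y | y \<in> V \<and> N y \<in> ?P. g y)"
    using assms(1) by (intro sum.group) auto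
  also have "\<dots> \<le> (\<Sum>y | y \<in> ?P \<and> N y \<in> ?P. g y)"
  proof -
    have "(\<Sum>y | y \<in> V \<and> N y \<in> ?P. g y) = (\<Sum>y | y \<in> ?P \<and> N y \<in> ?P. g y)
      + (\<Sum>y | y \<in> V - ?P \<and> N y \<in> ?P. g y)"
      using assms(1) by (subst sum.union_disjoint[symmetric]) (auto intro!: sum.cong)
    moreover have "(\<Sum>y | y \<in> V - ?P \<and> N y \<in> ?P. g y) \<le> 0"
      by (intro sum_nonpos) auto
    ultimately show ?thesis by simp
  qed
  also have "\<dots> \<le> sum g (?P - {x})"
    using neg assms(1) by (intro sum_mono2) auto
  also have "\<dots> < sum g ?P"
    using x fin by (simp add: sum.remove[of ?P x])
  finally show False by simp
qed

text \<open>The edges \<open>t x\<close> form a functional graph, on which a circulation is an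
  invariant signed measure. Its positive set and its negative set are both closed under the map, so
  each of them, if nonempty, contains \<open>r\<close>. Hence only one sign occurs, and total mass 0
  leaves nothing. The mass condition is essential: the chosen edges still contain a cycle through
  \<open>r\<close>.\<close>

lemma support_on_choice_zero:
  fixes d :: "'e \<Rightarrow> real" and t :: "'v \<Rightarrow> 'e"
  assumes fin: "finite V" "finite E"
    and t: "\<And>x. x \<in> V \<Longrightarrow> t x \<in> E \<and> st (t x) = x \<and> ar (t x) \<in> V"
    and reach: "\<And>P. P \<subseteq> V \<Longrightarrow> P \<noteq> {} \<Longrightarrow> (\<And>x. x \<in> P \<Longrightarrow> ar (t x) \<in> P) \<Longrightarrow> r \<in> P"
    and d: "flow E st ar d" "sum d E = 0" "\<And>e. e \<notin> t ` V \<Longrightarrow> d e = 0"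
  shows "d = (\<lambda>e. 0)"
proof -
  have inj: "inj_on t V" by (rule inj_on_inverseI[of _ st]) (simp add: t)
  \<comment> \<open>Since \<open>t\<close> selects one edge per vertex and \<open>d\<close> vanishes
    elsewhere, every edge sum becomes a sum over vertices.\<close>
  have sumE: "(\<Sum>e | e \<in> E \<and> Q e. d e) = (\<Sum>y | y \<in> V \<and> Q (t y). d (t y))" for Q
  proof -
    have "(\<Sum>e | e \<in> E \<and> Q e. d e) = sum d (t ` {y \<in> V. Q (t y)})"
    proof (rule sum.mono_neutral_right)
      show "\<forall>e\<in>{e \<in> E. Q e} - t ` {y \<in> V. Q (t y)}. d e = 0"
      proof
        fix e assume e: "e \<in> {e \<in> E. Q e} - t ` {y \<in> V. Q (t y)}"
        then have "e \<notin> t ` V" by auto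
        then show "d e = 0" by (rule d(3))
      qed
      show "t ` {y \<in> V. Q (t y)} \<subseteq> {e \<in> E. Q e}"
        using t by auto
    qed (use fin in simp)
    also have "\<dots> = (\<Sum>y | y \<in> V \<and> Q (t y). d (t y))"
      using inj by (subst sum.reindex) (auto simp: inj_on_def)
    finally show ?thesis .
  qed
  define N where "N x = ar (t x)" for x
  define g where "g x = d (t x)" for x
  have inv: "g x = (\<Sum>y | y \<in> V \<and> N y = x. g y)" if "x \<in> V" for x
  proof -
    have "g x = (\<Sum>y | y \<in> V \<and> st (t y) = x. d (t y))"
    proof -
      have "{y \<in> V. st (t y) = x} = {x}" using t that by auto
      then show ?thesis by (simp add: g_def)
    qed
    also have "\<dots> = (\<Sum>e | e \<in> E \<and> st e = x. d e)" by (simp add: sumE)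
    also have "\<dots> = (\<Sum>e | e \<in> E \<and> ar e = x. d e)" using d(1) by (simp add: flow_def)
    also have "\<dots> = (\<Sum>y | y \<in> V \<and> N y = x. g y)" by (simp add: sumE N_def g_def)
    finally show ?thesis .
  qed
  have NV: "N x \<in> V" if "x \<in> V" for x using t that by (simp add: N_def)
  have sum_g: "sum g V = 0"
    using sumE[of "\<lambda>_. True"] d(2) by (simp add: g_def)
  have P: "g r > 0" if "x \<in> V" "g x > 0" for x
    using reach[of "{x \<in> V. g x > 0}"] positive_set_invariant[OF fin(1) NV inv] that NV
    by (auto simp: N_def)
  have inv': "- g x = (\<Sum>y | y \<in> V \<and> N y = x. - g y)" if "x \<in> V" for x
    using inv[OF that] by (simp add: sum_negf)
  have M: "- g r > 0" if "x \<in> V" "- g x > 0" for x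
    using reach[of "{x \<in> V. - g x > 0}"] positive_set_invariant[of V N "\<lambda>x. - g x", OF fin(1) NV inv'] that NV
    by (auto simp: N_def)
  have "g x = 0" if "x \<in> V" for x
  proof (cases "\<exists>x\<in>V. g x > 0")
    case True
    then have "\<forall>x\<in>V. 0 \<le> g x" using P M by force
    then show ?thesis using sum_g that fin(1) by (simp add: sum_nonneg_eq_0_iff)
  next
    case False
    then have "\<forall>x\<in>V. 0 \<le> - g x" by force
    moreover have "sum (\<lambda>x. - g x) V = 0" using sum_g by (simp add: sum_negf)
    ultimately show ?thesis using that fin(1) sum_nonneg_eq_0_iff[of V "\<lambda>x. - g x"] by simp
  qed
  then have "d e = 0" for e
    using d(3)[of e] by (cases "e \<in> t ` V") (auto simp: g_def)
  then show ?thesis by (rule ext)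
qed

text \<open>Every vertex other than the root chooses an edge decreasing the distance to the root.\<close>

lemma exists_choice_to_root:
  fixes V :: "'v set" and E :: "'e set"
  assumes ends: "\<And>e. e \<in> E \<Longrightarrow> st e \<in> V \<and> ar e \<in> V"
    and out: "\<And>x. x \<in> V \<Longrightarrow> \<exists>e\<in>E. st e = x"
    and conn: "\<And>x y. x \<in> V \<Longrightarrow> y \<in> V \<Longrightarrow> (x, y) \<in> {(st e, ar e) | e. e \<in> E}\<^sup>*"
  obtains t r where "\<And>x. x \<in> V \<Longrightarrow> t x \<in> E \<and> st (t x) = x \<and> ar (t x) \<in> V"
    and "\<And>P. P \<subseteq> V \<Longrightarrow> P \<noteq> {} \<Longrightarrow> (\<And>x. x \<in> P \<Longrightarrow> ar (t x) \<in> P) \<Longrightarrow> r \<in> P"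
proof (cases "V = {}")
  case True
  then show ?thesis by (intro that[of undefined undefined]) auto
next
  case False
  then obtain r where r: "r \<in> V" by blast
  let ?R = "{(st e, ar e) | e. e \<in> E}"
  define dst where "dst x = (LEAST n. (x, r) \<in> ?R ^^ n)" for x
  have dst: "(x, r) \<in> ?R ^^ dst x" if "x \<in> V" for x
    unfolding dst_def using rtrancl_imp_relpow[OF conn[OF that r]] by (rule LeastI_ex)
  \<comment> \<open>The root takes any outgoing edge, which gives \<open>card V\<close> chosen edges
    rather than the \<open>card V - 1\<close> of a spanning tree.\<close>
  have "\<exists>e\<in>E. st e = x \<and> (x \<noteq> r \<longrightarrow> dst (ar e) < dst x)" if x: "x \<in> V" for x
  proof (cases "x = r")
    case True
    then show ?thesis using out x by blast
  next
    case False
    with dst[OF x] obtain n where n: "dst x = Suc n" by (cases "dst x") auto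
    with dst[OF x] have "(x, r) \<in> ?R ^^ Suc n" by simp
    then obtain y where y: "(x, y) \<in> ?R" "(y, r) \<in> ?R ^^ n" by (rule relpow_Suc_E2)
    have "dst y \<le> n" unfolding dst_def using y(2) by (rule Least_le)
    with y(1) n show ?thesis by fastforce
  qed
  then obtain t where t: "\<And>x. x \<in> V \<Longrightarrow> t x \<in> E \<and> st (t x) = x \<and> (x \<noteq> r \<longrightarrow> dst (ar (t x)) < dst x)"
    by metis
  show ?thesis
  proof (rule that[of t r])
    show "t x \<in> E \<and> st (t x) = x \<and> ar (t x) \<in> V" if "x \<in> V" for x
      using t[OF that] ends by blast
    fix P assume P: "P \<subseteq> V" "P \<noteq> {}" "\<And>x. x \<in> P \<Longrightarrow> ar (t x) \<in> P"
    \<comment> \<open>Inside a closed set the distance to the root keeps falling until the root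
      itself is met.\<close>
    have "r \<in> P" if "x \<in> P" for x
      using that
    proof (induction "dst x" arbitrary: x rule: less_induct)
      case less
      then show ?case using t P by (cases "x = r") blast+
    qed
    then show "r \<in> P" using P(2) by blast
  qed
qed

text \<open>All functions on the edge type may form an infinite-dimensional space, so the dimension
  is bounded through an explicit finite spanning set.\<close>

lemma in_span_indicators:
  fixes f :: "'e \<Rightarrow> real"
  assumes "finite F" "\<And>e. e \<notin> F \<Longrightarrow> f e = 0"
  shows "f \<in> span ((\<lambda>e x. if x = e then 1 else 0) ` F)"
  using assms
proof (induction F arbitrary: f rule: finite_induct)
  case empty
  then have "f = 0" by (auto simp: zero_fun_def)
  then show ?case by (simp only: span_zero)
next
  case (insert a F)
  let ?u = "\<lambda>e x. if x = e then 1 else (0::real)"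
  let ?g = "\<lambda>x. if x = a then 0 else f x"
  have "?g \<in> span (?u ` F)" using insert.prems by (intro insert.IH) auto
  then have "?g \<in> span (?u ` insert a F)" by (meson in_mono span_mono image_mono subset_insertI)
  moreover have "f a *\<^sub>R ?u a \<in> span (?u ` insert a F)"
    by (intro span_scale span_base) simp
  ultimately have "?g + f a *\<^sub>R ?u a \<in> span (?u ` insert a F)" by (rule span_add)
  moreover have "?g + f a *\<^sub>R ?u a = f" by (auto simp: fun_eq_iff scaleR_fun_def)
  ultimately show ?case by simp
qed

text \<open>Forgetting the chosen edges is injective on circulations of mass 0, and only
  \<open>card E - card V\<close> coordinates survive. The first conclusion ensures that this natural
  subtraction is not truncated.\<close>

lemma dim_flow_le:
  fixes V :: "'v set" and E :: "'e set"
  assumes fin: "finite V" "finite E"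
    and ends: "\<And>e. e \<in> E \<Longrightarrow> st e \<in> V \<and> ar e \<in> V"
    and out: "\<And>x. x \<in> V \<Longrightarrow> \<exists>e\<in>E. st e = x"
    and conn: "\<And>x y. x \<in> V \<Longrightarrow> y \<in> V \<Longrightarrow> (x, y) \<in> {(st e, ar e) | e. e \<in> E}\<^sup>*"
    and D: "D \<subseteq> {d. flow E st ar d \<and> sum d E = 0}"
  shows "card V \<le> card E" and "dim D \<le> card E - card V"
proof -
  obtain t r where t: "\<And>x. x \<in> V \<Longrightarrow> t x \<in> E \<and> st (t x) = x \<and> ar (t x) \<in> V"
    and reach: "\<And>P. P \<subseteq> V \<Longrightarrow> P \<noteq> {} \<Longrightarrow> (\<And>x. x \<in> P \<Longrightarrow> ar (t x) \<in> P) \<Longrightarrow> r \<in> P"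
    using exists_choice_to_root[OF ends out conn] by blast
  have card_T: "card (t ` V) = card V"
    by (intro card_image inj_on_inverseI[of _ st]) (simp add: t)
  have TE: "t ` V \<subseteq> E" using t by blast
  show "card V \<le> card E" using card_mono[OF fin(2) TE] card_T by simp
  let ?W = "{d. flow E st ar d \<and> sum d E = 0}"
  have subW: "subspace ?W"
    by (auto simp: subspace_def flow_def sum.distrib scaleR_fun_def simp flip: sum_distrib_left)
  let ?F = "E - t ` V"
  let ?R = "\<lambda>(d::'e \<Rightarrow> real) e. if e \<in> ?F then d e else 0"
  have lin: "linear ?R"
    by (intro linearI) (auto simp: fun_eq_iff scaleR_fun_def)
  \<comment> \<open>\<open>D\<close> need not be a subspace; the restriction is therefore studied on
    the span of a basis, which still consists of circulations of mass 0.\<close>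
  obtain b where b: "b \<subseteq> D" "independent b" "D \<subseteq> span b" "card b = dim D"
    using basis_exists[of D] by blast
  have span_b: "span b \<subseteq> ?W"
    using b(1) D subW by (intro span_minimal) auto
  have inj: "inj_on ?R (span b)"
  proof (rule inj_onI)
    fix f g assume fg: "f \<in> span b" "g \<in> span b" "?R f = ?R g"
    have W: "f - g \<in> ?W"
      using fg span_b subspace_diff[OF subW] by blast
    have "(f - g) e = 0" if "e \<notin> t ` V" for e
    proof (cases "e \<in> E")
      case True
      then show ?thesis using fun_cong[OF fg(3), of e] that by simp
    next
      case False
      then show ?thesis using W by (simp add: flow_def)
    qed
    then have "f - g = (\<lambda>e. 0)"
      using W by (intro support_on_choice_zero[OF fin t reach]) auto
    then show "f = g" by (simp add: fun_eq_iff)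
  qed
  have indep: "independent (?R ` b)"
    using linear_independent_injective_image[OF lin b(2)] inj by blast
  let ?U = "(\<lambda>e x. if x = e then 1 else (0::real)) ` ?F"
  have "?R ` b \<subseteq> span ?U"
  proof (rule image_subsetI)
    show "?R d \<in> span ?U" for d
      using fin(2) by (intro in_span_indicators) auto
  qed
  with indep fin(2) have "card (?R ` b) \<le> card ?U"
    by (intro independent_span_bound[THEN conjunct2]) auto
  also have "\<dots> \<le> card ?F" using fin(2) by (intro card_image_le) auto
  also have "\<dots> = card E - card V"
    using TE card_T fin by (simp add: card_Diff_subset)
  finally have "card (?R ` b) \<le> card E - card V" .
  moreover have "card (?R ` b) = card b"
    using inj by (intro card_image) (meson inj_on_subset span_superset)
  ultimately show "dim D \<le> card E - card V" using b(4) by simp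
qed

section \<open>Feasible vectors\<close>

text \<open>Feasibility becomes approximability by arbitrarily long members of the class. One
  \<epsilon> serves all patterns because \<open>perms k\<close> is finite. Closedness and convexity
  then need no diagonal choice of sequences.\<close>

lemma feasible_iff:
  "v \<in> feasible k B \<longleftrightarrow> v \<in> cube k \<and>
    (\<forall>\<epsilon>>0. \<forall>N. \<exists>\<sigma>\<in>Av B. N \<le> length \<sigma> \<and> (\<forall>\<pi>\<in>perms k. \<bar>cocc_prop \<pi> \<sigma> - v \<pi>\<bar> < \<epsilon>))"
  (is "_ \<longleftrightarrow> _ \<and> ?approx")
proof (intro iffI conjI)
  assume v: "v \<in> feasible k B"
  then show "v \<in> cube k" by (simp add: feasible_def)
  obtain \<sigma> where \<sigma>: "\<And>m. \<sigma> m \<in> Av B" "filterlim (\<lambda>m. length (\<sigma> m)) at_top sequentially"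
    "\<And>\<pi>. \<pi> \<in> perms k \<Longrightarrow> (\<lambda>m. cocc_prop \<pi> (\<sigma> m)) \<longlonglongrightarrow> v \<pi>"
    using v by (auto simp: feasible_def)
  show ?approx
  proof (intro allI impI)
    fix \<epsilon> :: real and N :: nat assume "\<epsilon> > 0"
    have "eventually (\<lambda>m. N \<le> length (\<sigma> m)) sequentially"
      using \<sigma>(2) by (simp add: filterlim_at_top)
    moreover have "eventually (\<lambda>m. \<forall>\<pi>\<in>perms k. \<bar>cocc_prop \<pi> (\<sigma> m) - v \<pi>\<bar> < \<epsilon>) sequentially"
      using tendstoD[OF \<sigma>(3) \<open>\<epsilon> > 0\<close>]
      by (intro eventually_ball_finite finite_perms) (simp add: dist_real_def)
    ultimately have "eventually (\<lambda>m. N \<le> length (\<sigma> m) \<and>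
        (\<forall>\<pi>\<in>perms k. \<bar>cocc_prop \<pi> (\<sigma> m) - v \<pi>\<bar> < \<epsilon>)) sequentially"
      by (rule eventually_conj)
    from eventually_happens'[OF sequentially_bot this] show "\<exists>\<sigma>\<in>Av B. N \<le> length \<sigma> \<and> (\<forall>\<pi>\<in>perms k. \<bar>cocc_prop \<pi> \<sigma> - v \<pi>\<bar> < \<epsilon>)"
      using \<sigma>(1) by blast
  qed
next
  assume *: "v \<in> cube k \<and> ?approx"
  then have "\<exists>\<sigma>. \<sigma> \<in> Av B \<and> m \<le> length \<sigma> \<and> (\<forall>\<pi>\<in>perms k. \<bar>cocc_prop \<pi> \<sigma> - v \<pi>\<bar> < inverse (Suc m))" for m
    by (meson inverse_positive_iff_positive of_nat_0_less_iff zero_less_Suc)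
  then obtain \<sigma> where \<sigma>: "\<And>m. \<sigma> m \<in> Av B" "\<And>m. m \<le> length (\<sigma> m)"
    "\<And>m \<pi>. \<pi> \<in> perms k \<Longrightarrow> \<bar>cocc_prop \<pi> (\<sigma> m) - v \<pi>\<bar> < inverse (Suc m)"
    by metis
  have "filterlim (\<lambda>m. length (\<sigma> m)) at_top sequentially"
    by (rule filterlim_at_top_mono[OF filterlim_ident]) (simp add: \<sigma>)
  moreover have "(\<lambda>m. cocc_prop \<pi> (\<sigma> m)) \<longlonglongrightarrow> v \<pi>" if "\<pi> \<in> perms k" for \<pi>
  proof -
    have "(\<lambda>m. cocc_prop \<pi> (\<sigma> m) - v \<pi>) \<longlonglongrightarrow> 0"
      using \<sigma>(3)[OF that] by (intro Lim_null_comparison[OF _ LIMSEQ_inverse_real_of_nat])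
        (auto intro!: always_eventually less_imp_le)
    then show ?thesis by (rule LIM_zero_cancel)
  qed
  ultimately show "v \<in> feasible k B"
    using * \<sigma>(1) unfolding feasible_def by blast
qed

text \<open>The topology is the product topology, so limits are taken coordinatewise; a permutation
  that approximates a nearby feasible point also approximates the limit.\<close>

lemma closed_feasible: "closed (feasible k B)"
  unfolding closed_sequential_limits
proof (intro allI impI)
  fix X l assume "(\<forall>n. X n \<in> feasible k B) \<and> X \<longlonglongrightarrow> l"
  then have X: "\<And>n. X n \<in> feasible k B" and "X \<longlonglongrightarrow> l" by auto
  have lim: "(\<lambda>n. X n \<pi>) \<longlonglongrightarrow> l \<pi>" for \<pi>
    by (rule continuous_on_tendsto_compose[OF continuous_on_product_coordinates \<open>X \<longlonglongrightarrow> l\<close>]) auto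
  have cube: "X n \<in> cube k" for n using X feasible_iff by blast
  have "0 \<le> l \<pi> \<and> l \<pi> \<le> 1" if "\<pi> \<in> perms k" for \<pi>
    using cube that LIMSEQ_le_const[OF lim, of 0 \<pi>] LIMSEQ_le_const2[OF lim, of \<pi> 1]
    by (simp add: cube_def)
  moreover have "l \<pi> = 0" if "\<pi> \<notin> perms k" for \<pi>
  proof -
    have "(\<lambda>n. X n \<pi>) = (\<lambda>n. 0)" using cube that by (simp add: cube_def)
    then show ?thesis using lim[of \<pi>] by (simp add: LIMSEQ_const_iff)
  qed
  ultimately have "l \<in> cube k" by (simp add: cube_def)
  moreover have "\<exists>\<sigma>\<in>Av B. N \<le> length \<sigma> \<and> (\<forall>\<pi>\<in>perms k. \<bar>cocc_prop \<pi> \<sigma> - l \<pi>\<bar> < \<epsilon>)"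
    if eps: "\<epsilon> > 0" for \<epsilon> N
  proof -
    have "eventually (\<lambda>n. \<forall>\<pi>\<in>perms k. \<bar>X n \<pi> - l \<pi>\<bar> < \<epsilon> / 2) sequentially"
      using tendstoD[OF lim, of "\<epsilon> / 2"] eps
      by (intro eventually_ball_finite finite_perms) (simp add: dist_real_def)
    from eventually_happens'[OF sequentially_bot this]
    obtain n where n: "\<forall>\<pi>\<in>perms k. \<bar>X n \<pi> - l \<pi>\<bar> < \<epsilon> / 2" by blast
    obtain \<sigma> where \<sigma>: "\<sigma> \<in> Av B" "N \<le> length \<sigma>" "\<forall>\<pi>\<in>perms k. \<bar>cocc_prop \<pi> \<sigma> - X n \<pi>\<bar> < \<epsilon> / 2"
      using X[of n] eps unfolding feasible_iff by (meson half_gt_zero)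
    have "\<bar>cocc_prop \<pi> \<sigma> - l \<pi>\<bar> < \<epsilon>" if "\<pi> \<in> perms k" for \<pi>
    proof -
      have "\<bar>X n \<pi> - l \<pi>\<bar> < \<epsilon> / 2" "\<bar>cocc_prop \<pi> \<sigma> - X n \<pi>\<bar> < \<epsilon> / 2"
        using n \<sigma>(3) that by auto
      then show ?thesis by linarith
    qed
    then show ?thesis using \<sigma> by blast
  qed
  ultimately show "l \<in> feasible k B"
    unfolding feasible_iff by blast
qed

section \<open>Feasible vectors are circulations\<close>

text \<open>Every window of a member of the class is an edge, so no position is lost.
  \<open>Q\<close> will be a condition on one endpoint for conservation, and trivial for the total
  mass.\<close>

lemma sum_cocc_eq_card:
  assumes "\<sigma> \<in> Av_n n B" "k \<ge> 1"
  shows "(\<Sum>\<pi> | \<pi> \<in> Av_n k B \<and> Q \<pi>. cocc \<pi> \<sigma>) = card {i. i + k \<le> n \<and> Q (win k i \<sigma>)}"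
proof -
  have len: "length \<sigma> = n" using Av_nD[OF assms(1)] by simp
  have fin: "finite {i. i + k \<le> n \<and> R i}" for R
    by (rule finite_subset[of _ "{..n}"]) auto
  have "(\<Sum>\<pi> | \<pi> \<in> Av_n k B \<and> Q \<pi>. cocc \<pi> \<sigma>)
    = (\<Sum>\<pi> | \<pi> \<in> Av_n k B \<and> Q \<pi>. card {i. i + k \<le> n \<and> win k i \<sigma> = \<pi>})"
    using Av_nD assms(2) len by (intro sum.cong) (auto simp: cocc_eq_card_win)
  also have "\<dots> = card (\<Union>\<pi>\<in>{\<pi> \<in> Av_n k B. Q \<pi>}. {i. i + k \<le> n \<and> win k i \<sigma> = \<pi>})"
    using fin finite_Av_n by (intro card_UN_disjoint[symmetric]) auto
  also have "(\<Union>\<pi>\<in>{\<pi> \<in> Av_n k B. Q \<pi>}. {i. i + k \<le> n \<and> win k i \<sigma> = \<pi>})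
    = {i. i + k \<le> n \<and> Q (win k i \<sigma>)}"
    using win_in_Av_n[OF assms(1)] by auto
  finally show ?thesis .
qed

lemma overlap_ends:
  assumes "\<pi> \<in> Av_n k B" "k \<ge> 1"
  shows "pat {1..k - 1} \<pi> = win (k - 1) 0 \<pi>" "pat {2..k} \<pi> = win (k - 1) 1 \<pi>"
  using Av_nD[OF assms(1)] assms(2) pat_init pat_tail by auto

lemma card_shifted_windows:
  "\<bar>int (card {i. i + k \<le> n \<and> P i}) - int (card {i. i + k \<le> n \<and> P (Suc i)})\<bar> \<le> 1"
proof -
  let ?A = "{i. i + k \<le> n \<and> P i}" and ?B = "{i. i + k \<le> n \<and> P (Suc i)}"
  have finA: "finite ?A" and finB: "finite ?B"
    by (rule finite_subset[of _ "{..n}"]; auto)+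
  have "?A \<subseteq> insert 0 (Suc ` ?B)"
  proof
    fix i assume "i \<in> ?A"
    then show "i \<in> insert 0 (Suc ` ?B)" by (cases i) auto
  qed
  then have "card ?A \<le> card (insert 0 (Suc ` ?B))"
    using finB by (intro card_mono) auto
  also have "\<dots> \<le> Suc (card ?B)"
    using finB by (simp add: card_insert_if card_image)
  finally have 1: "card ?A \<le> Suc (card ?B)" .
  \<comment> \<open>The shift leaves \<open>?A\<close> only at the last position,
    \<open>Suc n - k\<close>.\<close>
  have "Suc ` ?B \<subseteq> insert (Suc n - k) ?A" by auto
  then have "card (Suc ` ?B) \<le> card (insert (Suc n - k) ?A)"
    using finA by (intro card_mono) auto
  also have "\<dots> \<le> Suc (card ?A)"
    using finA by (simp add: card_insert_if)
  finally have "card ?B \<le> Suc (card ?A)"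
    by (simp add: card_image)
  with 1 show ?thesis by linarith
qed

lemma feasible_flow:
  assumes "v \<in> feasible k B" "k \<ge> 1"
  shows "flow (Av_n k B) (\<lambda>\<pi>. pat {1..k - 1} \<pi>) (\<lambda>\<pi>. pat {2..k} \<pi>) v"
    and "\<And>\<pi>. 0 \<le> v \<pi>" and "sum v (Av_n k B) = 1"
proof -
  let ?E = "Av_n k B" and ?st = "\<lambda>\<pi>. pat {1..k - 1} \<pi>" and ?ar = "\<lambda>\<pi>. pat {2..k} \<pi>"
  have cube: "v \<in> cube k" using assms by (simp add: feasible_def)
  then show "0 \<le> v \<pi>" for \<pi> by (cases "\<pi> \<in> perms k") (auto simp: cube_def)
  obtain \<sigma> where Av: "\<And>m. \<sigma> m \<in> Av B" and len: "filterlim (\<lambda>m. length (\<sigma> m)) at_top sequentially"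
    and lim: "\<And>\<pi>. \<pi> \<in> perms k \<Longrightarrow> (\<lambda>m. cocc_prop \<pi> (\<sigma> m)) \<longlonglongrightarrow> v \<pi>"
    using assms by (auto simp: feasible_def)
  have \<sigma>: "\<sigma> m \<in> Av_n (length (\<sigma> m)) B" for m using Av Av_iff by blast
  have len_pos: "length (\<sigma> m) > 0" for m using Av Av_iff by blast
  have E_perms: "?E \<subseteq> perms k" by (auto simp: Av_n_def)
  have lim_const: "(\<lambda>m. c / real (length (\<sigma> m))) \<longlonglongrightarrow> 0" for c
    using len by (intro tendsto_divide_0[OF tendsto_const] filterlim_at_top_imp_at_infinity
      filterlim_compose[OF filterlim_real_sequentially])
  have lim_sum: "(\<lambda>m. real (card {i. i + k \<le> length (\<sigma> m) \<and> Q (win k i (\<sigma> m))}) / length (\<sigma> m))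
      \<longlonglongrightarrow> (\<Sum>\<pi> | \<pi> \<in> ?E \<and> Q \<pi>. v \<pi>)" for Q
  proof -
    have "(\<lambda>m. \<Sum>\<pi> | \<pi> \<in> ?E \<and> Q \<pi>. cocc_prop \<pi> (\<sigma> m)) \<longlonglongrightarrow> (\<Sum>\<pi> | \<pi> \<in> ?E \<and> Q \<pi>. v \<pi>)"
      using E_perms by (intro tendsto_sum lim) auto
    moreover have "(\<Sum>\<pi> | \<pi> \<in> ?E \<and> Q \<pi>. cocc_prop \<pi> (\<sigma> m))
      = real (card {i. i + k \<le> length (\<sigma> m) \<and> Q (win k i (\<sigma> m))}) / length (\<sigma> m)" for m
      unfolding cocc_prop_def sum_cocc_eq_card[OF \<sigma> assms(2), symmetric]
      by (simp add: sum_divide_distrib)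
    ultimately show ?thesis by simp
  qed
  have "v \<pi> = 0" if "\<pi> \<notin> ?E" for \<pi>
  proof (cases "\<pi> \<in> perms k")
    case True
    have "cocc \<pi> (\<sigma> m) = 0" for m
    proof -
      have "length \<pi> = k" using True by (simp add: perms_def)
      moreover have "{i. i + k \<le> length (\<sigma> m) \<and> win k i (\<sigma> m) = \<pi>} = {}"
        using win_in_Av_n[OF \<sigma>] that by auto
      ultimately show ?thesis using cocc_eq_card_win assms(2) by (metis card.empty)
    qed
    then have "(\<lambda>m. cocc_prop \<pi> (\<sigma> m)) = (\<lambda>m. 0)" by (simp add: cocc_prop_def)
    then show ?thesis using lim[OF True] by (simp add: LIMSEQ_const_iff)
  next
    case False
    then show ?thesis using cube by (simp add: cube_def)
  qed
  moreover have "(\<Sum>\<pi> | \<pi> \<in> ?E \<and> ?st \<pi> = x. v \<pi>) = (\<Sum>\<pi> | \<pi> \<in> ?E \<and> ?ar \<pi> = x. v \<pi>)" for x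
  proof -
    let ?a = "\<lambda>m. real (card {i. i + k \<le> length (\<sigma> m) \<and> ?st (win k i (\<sigma> m)) = x})"
    let ?b = "\<lambda>m. real (card {i. i + k \<le> length (\<sigma> m) \<and> ?ar (win k i (\<sigma> m)) = x})"
    \<comment> \<open>Read along a permutation, the edge at position \<open>i\<close> starts at the
      short window at \<open>i\<close> and arrives at the one at \<open>Suc i\<close>. Outflow and
      inflow at \<open>x\<close> thus count the same sequence of short windows, shifted by
      one.\<close>
    have ends: "?st (win k i (\<sigma> m)) = win (k - 1) i (\<sigma> m)" "?ar (win k i (\<sigma> m)) = win (k - 1) (Suc i) (\<sigma> m)"
      if "i + k \<le> length (\<sigma> m)" for i m
      using overlap_ends[OF win_in_Av_n[OF \<sigma> that] assms(2)] assms(2) by (simp_all add: win_win)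
    have "\<bar>?a m - ?b m\<bar> \<le> 1" for m
    proof -
      have "{i. i + k \<le> length (\<sigma> m) \<and> ?st (win k i (\<sigma> m)) = x}
        = {i. i + k \<le> length (\<sigma> m) \<and> win (k - 1) i (\<sigma> m) = x}"
        "{i. i + k \<le> length (\<sigma> m) \<and> ?ar (win k i (\<sigma> m)) = x}
        = {i. i + k \<le> length (\<sigma> m) \<and> win (k - 1) (Suc i) (\<sigma> m) = x}"
        using ends by auto
      then show ?thesis
        using card_shifted_windows[of k "length (\<sigma> m)" "\<lambda>i. win (k - 1) i (\<sigma> m) = x"] by simp
    qed
    then have "norm (?a m / length (\<sigma> m) - ?b m / length (\<sigma> m)) \<le> 1 / length (\<sigma> m)" for m
      using len_pos[of m] by (simp add: divide_right_mono flip: diff_divide_distrib)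
    then have "(\<lambda>m. ?a m / length (\<sigma> m) - ?b m / length (\<sigma> m)) \<longlonglongrightarrow> 0"
      by (intro Lim_null_comparison[OF always_eventually lim_const[of 1]]) blast
    then have "(\<Sum>\<pi> | \<pi> \<in> ?E \<and> ?st \<pi> = x. v \<pi>) - (\<Sum>\<pi> | \<pi> \<in> ?E \<and> ?ar \<pi> = x. v \<pi>) = 0"
      using tendsto_diff[OF lim_sum[of "\<lambda>\<pi>. ?st \<pi> = x"] lim_sum[of "\<lambda>\<pi>. ?ar \<pi> = x"]]
        LIMSEQ_unique by blast
    then show ?thesis by simp
  qed
  ultimately show "flow ?E ?st ?ar v"
    by (auto simp: flow_def)
  have "card {i. i + k \<le> n} = Suc n - k" for n
  proof -
    have "{i. i + k \<le> n} = {..<Suc n - k}" by auto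
    then show ?thesis by simp
  qed
  then have *: "(\<lambda>m. real (Suc (length (\<sigma> m)) - k) / length (\<sigma> m)) \<longlonglongrightarrow> sum v ?E"
    using lim_sum[of "\<lambda>_. True"] by simp
  \<comment> \<open>There are \<open>Suc n - k\<close> windows in length n. The subtraction stops at
    0 for very short permutations, and the error bound k covers them too.\<close>
  have "norm (real (Suc (length (\<sigma> m)) - k) / length (\<sigma> m) - 1) \<le> real k / length (\<sigma> m)" for m
  proof -
    have "real (Suc (length (\<sigma> m)) - k) / length (\<sigma> m) - 1
      = (real (Suc (length (\<sigma> m)) - k) - length (\<sigma> m)) / length (\<sigma> m)"
      using len_pos[of m] by (simp add: diff_divide_distrib)
    moreover have "\<bar>real (Suc (length (\<sigma> m)) - k) - length (\<sigma> m)\<bar> \<le> k"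
      using assms(2) by linarith
    ultimately show ?thesis by (simp add: divide_right_mono)
  qed
  then have "(\<lambda>m. real (Suc (length (\<sigma> m)) - k) / length (\<sigma> m) - 1) \<longlonglongrightarrow> 0"
    by (intro Lim_null_comparison[OF always_eventually lim_const[of k]]) blast
  then have "(\<lambda>m. real (Suc (length (\<sigma> m)) - k) / length (\<sigma> m)) \<longlonglongrightarrow> 1"
    by (rule LIM_zero_cancel)
  then show "sum v ?E = 1"
    using * LIMSEQ_unique by blast
qed

lemma feasible_subset_overlap_polytope:
  assumes "k \<ge> 1"
  shows "feasible k B \<subseteq> overlap_polytope k B"
proof
  fix v assume "v \<in> feasible k B"
  from feasible_flow[OF this assms] show "v \<in> overlap_polytope k B"
    using flow_in_cycle_polytope[OF finite_Av_n, of k B _ _ v] by (simp add: overlap_polytope_def)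
qed

section \<open>Walks in the overlap graph come from permutations\<close>

lemma between_avoiding:
  fixes L U X :: "real set"
  assumes fin: "finite L" "finite U" "finite X" and lt: "\<And>l u. l \<in> L \<Longrightarrow> u \<in> U \<Longrightarrow> l < u"
  obtains y where "\<And>l. l \<in> L \<Longrightarrow> l < y" "\<And>u. u \<in> U \<Longrightarrow> y < u" "y \<notin> X"
proof -
  \<comment> \<open>The inserted elements are defaults for empty \<open>L\<close> or
    \<open>U\<close>: \<open>Min (insert 0 U) - 1\<close> lies below all of \<open>U\<close>, and
    \<open>a + 1\<close> lies above \<open>a\<close>.\<close>
  define a where "a = Max (insert (Min (insert 0 U) - 1) L)"
  define b where "b = Min (insert (a + 1) U)"
  have La: "l \<le> a" if "l \<in> L" for l
    using that fin by (simp add: a_def)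
  have "a < u" if "u \<in> U" for u
  proof -
    have "Min (insert 0 U) \<le> u" using that fin by simp
    then have "Min (insert 0 U) - 1 < u" by linarith
    then show ?thesis using that fin lt by (simp add: a_def)
  qed
  then have "a < b" using fin by (simp add: b_def)
  have bU: "b \<le> u" if "u \<in> U" for u
    using that fin by (simp add: b_def)
  have "infinite {a<..<b}" using \<open>a < b\<close> by (simp add: infinite_Ioo)
  then obtain y where "y \<in> {a<..<b}" "y \<notin> X"
    using fin(3) by (meson finite_subset subsetI)
  with La bU show ?thesis by (intro that[of y]) force+
qed

text \<open>The last entry of \<pi> separates the values of \<open>w\<close> into those that must
  stay below and those that must stay above the new one. \<open>X\<close> collects the values used
  earlier in the whole sequence, which have to remain distinct from it.\<close>

lemma extend_to_pattern:
  fixes w :: "real list"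
  assumes "distinct w" "finite X" "set w \<subseteq> X" and \<pi>: "\<pi> \<in> perms (Suc (length w))"
    and w: "std w = std (take (length w) \<pi>)"
  obtains y where "y \<notin> X" "std (w @ [y]) = \<pi>"
proof -
  let ?n = "length w"
  have len: "length \<pi> = Suc ?n" and dist: "distinct \<pi>" using \<pi> by (auto simp: perms_def)
  have less: "w ! i < w ! j \<longleftrightarrow> \<pi> ! i < \<pi> ! j" if "i < ?n" "j < ?n" for i j
    using std_nth_less_iff[of i w j] std_nth_less_iff[of i "take ?n \<pi>" j] that len w by simp
  obtain y where y: "\<And>l. l \<in> (!) w ` {i. i < ?n \<and> \<pi> ! i < \<pi> ! ?n} \<Longrightarrow> l < y"
    "\<And>u. u \<in> (!) w ` {i. i < ?n \<and> \<pi> ! ?n < \<pi> ! i} \<Longrightarrow> y < u" "y \<notin> X"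
  proof (rule between_avoiding[of "(!) w ` {i. i < ?n \<and> \<pi> ! i < \<pi> ! ?n}"
        "(!) w ` {i. i < ?n \<and> \<pi> ! ?n < \<pi> ! i}" X])
    fix l u assume "l \<in> (!) w ` {i. i < ?n \<and> \<pi> ! i < \<pi> ! ?n}" "u \<in> (!) w ` {i. i < ?n \<and> \<pi> ! ?n < \<pi> ! i}"
    then obtain i j where "i < ?n" "j < ?n" "l = w ! i" "u = w ! j" "\<pi> ! i < \<pi> ! ?n" "\<pi> ! ?n < \<pi> ! j"
      by blast
    then show "l < u" using less[of i j] by simp
  qed (use assms(2) in auto)
  have ne: "\<pi> ! i \<noteq> \<pi> ! ?n" if "i < ?n" for i
    using dist len that by (simp add: nth_eq_iff_index_eq)
  have wy: "w ! i < y \<longleftrightarrow> \<pi> ! i < \<pi> ! ?n" "y < w ! i \<longleftrightarrow> \<pi> ! ?n < \<pi> ! i" if "i < ?n" for i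
    using y(1)[of "w ! i"] y(2)[of "w ! i"] ne[OF that] that
    by (metis (mono_tags, lifting) image_eqI mem_Collect_eq linorder_neqE_nat order_less_asym)+
  have "std (w @ [y]) = std \<pi>"
  proof (rule std_eqI)
    show "distinct (w @ [y])" using assms y(3) by auto
    fix i j assume "i < length (w @ [y])" "j < length (w @ [y])"
    then consider "i < ?n" "j < ?n" | "i < ?n" "j = ?n" | "i = ?n" "j < ?n" | "i = ?n" "j = ?n"
      by fastforce
    then show "(w @ [y]) ! i \<le> (w @ [y]) ! j \<longleftrightarrow> \<pi> ! i \<le> \<pi> ! j"
      using less[of j i] wy[of i] wy[of j] by cases (auto simp: nth_append linorder_not_less[symmetric])
  qed (use dist len in auto)
  then show ?thesis
    using that[OF y(3)] std_perms[OF \<pi>] by simp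
qed

text \<open>Consecutive edges agree on their overlap, so the last k - 1 values already have the
  order of the first k - 1 entries of the next pattern, and one more value completes it. Earlier
  windows are untouched by the appended value. The length is \<open>length es + k - 1\<close>,
  stated without subtraction.\<close>

lemma realize_walk:
  fixes es :: "nat list list"
  assumes "k \<ge> 1" "es \<noteq> []"
    and "walk (perms k) (\<lambda>\<pi>. win (k - 1) 0 \<pi>) (\<lambda>\<pi>. win (k - 1) 1 \<pi>) es"
  shows "\<exists>xs :: real list. distinct xs \<and> Suc (length xs) = length es + k \<and> (\<forall>i<length es. win k i xs = es ! i)"
  using assms(2,3)
proof (induction es rule: rev_nonempty_induct)
  case (single \<pi>)
  then have \<pi>: "\<pi> \<in> perms k" by (simp add: walk_def)
  have "win k 0 (map real \<pi>) = std \<pi>"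
    using \<pi> by (simp add: win_def perms_def) (simp add: std_map strict_mono_on_def)
  then show ?case
    using \<pi> by (intro exI[of _ "map real \<pi>"]) (simp add: std_perms, simp add: perms_def distinct_map)
next
  case (snoc \<pi> es)
  let ?n = "length es"
  have \<pi>: "\<pi> \<in> perms k" and es: "set es \<subseteq> perms k" using snoc.prems by (auto simp: walk_def)
  have "walk (perms k) (\<lambda>\<pi>. win (k - 1) 0 \<pi>) (\<lambda>\<pi>. win (k - 1) 1 \<pi>) es"
    unfolding walk_def
  proof (intro conjI allI impI es)
    fix i assume "Suc i < ?n"
    then show "win (k - 1) 1 (es ! i) = win (k - 1) 0 (es ! Suc i)"
      using snoc.prems unfolding walk_def
      by (metis (no_types, lifting) Suc_lessD length_append_singleton less_SucI nth_append)
  qed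
  from snoc.IH[OF this] obtain xs :: "real list" where xs: "distinct xs" "Suc (length xs) = ?n + k"
    "\<And>i. i < ?n \<Longrightarrow> win k i xs = es ! i" by blast
  let ?w = "drop ?n xs"
  have n_pos: "?n > 0" using snoc by simp
  have len_w: "length ?w = k - 1" using xs(2) assms(1) by simp
  have "win (k - 1) 1 (es ! (?n - 1)) = win (k - 1) 0 \<pi>"
  proof -
    have "Suc (?n - 1) < length (es @ [\<pi>])" using n_pos by simp
    then have "win (k - 1) 1 ((es @ [\<pi>]) ! (?n - 1)) = win (k - 1) 0 ((es @ [\<pi>]) ! Suc (?n - 1))"
      using snoc.prems unfolding walk_def by blast
    then show ?thesis using n_pos by (simp add: nth_append)
  qed
  moreover have "win (k - 1) 1 (es ! (?n - 1)) = win (k - 1) ?n xs"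
    using xs(3)[of "?n - 1", symmetric] n_pos assms(1) by (simp add: win_win)
  ultimately have "std ?w = std (take (length ?w) \<pi>)"
    using len_w by (simp add: win_def)
  then obtain y where y: "y \<notin> set xs" "std (?w @ [y]) = \<pi>"
    using extend_to_pattern[of ?w "set xs" \<pi>] xs(1) \<pi> len_w assms(1) set_drop_subset[of ?n xs]
    by (auto simp: distinct_drop)
  have "win k i (xs @ [y]) = (es @ [\<pi>]) ! i" if i: "i < length (es @ [\<pi>])" for i
  proof (cases "i < ?n")
    case True
    then have "take k (drop i (xs @ [y])) = take k (drop i xs)" using xs(2) by (simp add: le_diff_conv2)
    then show ?thesis
      using xs(3)[OF True] True unfolding win_def by (simp add: nth_append del: take_append drop_append)
  next
    case False
    then have "i = ?n" using i by simp
    then have "take k (drop i (xs @ [y])) = ?w @ [y]" using xs(2) len_w assms(1) by simp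
    then show ?thesis using y(2) \<open>i = ?n\<close> by (simp add: win_def)
  qed
  then show ?case
    using xs y by (intro exI[of _ "xs @ [y]"]) auto
qed

section \<open>Repeating a cycle and its limiting frequencies\<close>

lemma cycle_append:
  assumes "cycle E st ar C" "cycle E st ar D" "st (hd C) = st (hd D)"
  shows "cycle E st ar (C @ D)" and "st (hd (C @ D)) = st (hd D)"
proof -
  have ne: "C \<noteq> []" "D \<noteq> []" using assms by (auto simp: cycle_def)
  show hd: "st (hd (C @ D)) = st (hd D)" using ne assms(3) by simp
  have "ar ((C @ D) ! i) = st ((C @ D) ! Suc i)" if "Suc i < length (C @ D)" for i
  proof -
    consider "Suc i < length C" | "Suc i = length C" | "i \<ge> length C" by linarith
    then show ?thesis
    proof cases
      case 1
      then show ?thesis using assms(1) by (simp add: nth_append cycle_def walk_def)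
    next
      case 2
      then have "(C @ D) ! i = last C" using ne
        by (simp add: nth_append last_conv_nth flip: 2)
      moreover have "(C @ D) ! Suc i = hd D" using 2 ne by (simp add: nth_append hd_conv_nth)
      ultimately show ?thesis using assms by (simp add: cycle_def)
    next
      case 3
      then obtain j where j: "i = length C + j" using le_Suc_ex by blast
      then show ?thesis using that assms(2) by (simp add: nth_append cycle_def walk_def)
    qed
  qed
  then show "cycle E st ar (C @ D)"
    using assms hd ne by (auto simp: cycle_def walk_def)
qed

lemma cycle_power:
  assumes "cycle E st ar C"
  shows "cycle E st ar (concat (replicate (Suc m) C)) \<and> st (hd (concat (replicate (Suc m) C))) = st (hd C)"
proof (induction m)
  case (Suc m)
  then show ?case using cycle_append[OF assms, of "concat (replicate (Suc m) C)"] by simp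
qed (simp add: assms)

lemma count_list_concat_replicate: "count_list (concat (replicate m C)) x = m * count_list C x"
  by (induction m) auto

lemma Av_empty: "Av {} = all_perms"
  by (simp add: Av_def Av_n_def all_perms_def)

text \<open>Windows of the realizing sequence correspond position by position to the edges of the
  repeated cycle, so occurrence counts are exact. Only the length deviates from proportionality, by
  the constant k - 1.\<close>

lemma cycle_vec_feasible:
  assumes "k \<ge> 1" and C: "cycle (perms k) (\<lambda>\<pi>. win (k - 1) 0 \<pi>) (\<lambda>\<pi>. win (k - 1) 1 \<pi>) C"
  shows "cycle_vec C \<in> feasible k {}"
proof -
  have C_sub: "set C \<subseteq> perms k" and "C \<noteq> []" using C by (auto simp: cycle_def walk_def)
  let ?es = "\<lambda>m. concat (replicate (Suc m) C)"
  have es_len: "length (?es m) = Suc m * length C" for m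
    by (simp add: length_concat sum_list_replicate)
  have "\<exists>xs :: real list. distinct xs \<and> Suc (length xs) = length (?es m) + k
      \<and> (\<forall>i<length (?es m). win k i xs = ?es m ! i)" for m
    using cycle_power[OF C, of m] assms(1) by (intro realize_walk) (auto simp: cycle_def)
  then obtain xs :: "nat \<Rightarrow> real list" where xs: "\<And>m. distinct (xs m)"
    "\<And>m. Suc (length (xs m)) = length (?es m) + k"
    "\<And>m i. i < length (?es m) \<Longrightarrow> win k i (xs m) = ?es m ! i"
    by metis
  define \<sigma> where "\<sigma> m = std (xs m)" for m
  have len: "length (\<sigma> m) = Suc m * length C + k - 1" for m
    using xs(2)[of m] es_len[of m] unfolding \<sigma>_def length_std by simp
  have len_ge: "m < length (\<sigma> m)" for m
  proof -
    have "Suc m * 1 \<le> Suc m * length C" using \<open>C \<noteq> []\<close> by (intro mult_le_mono) (auto simp: Suc_le_eq)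
    then show ?thesis using len[of m] assms(1) by simp
  qed
  have "\<sigma> m \<in> Av {}" for m
    unfolding Av_empty all_perms_def using std_in_perms[OF xs(1), of m] len_ge[of m]
    by (auto simp: \<sigma>_def intro!: bexI[of _ "length (xs m)"])
  moreover have "filterlim (\<lambda>m. length (\<sigma> m)) at_top sequentially"
    using len_ge by (intro filterlim_at_top_mono[OF filterlim_ident]) (auto intro!: always_eventually less_imp_le)
  moreover have "(\<lambda>m. cocc_prop \<pi> (\<sigma> m)) \<longlonglongrightarrow> cycle_vec C \<pi>" if "\<pi> \<in> perms k" for \<pi>
  proof -
    have cocc: "cocc \<pi> (\<sigma> m) = Suc m * count_list C \<pi>" for m
    proof -
      have "cocc \<pi> (\<sigma> m) = card {i. i + k \<le> length (\<sigma> m) \<and> win k i (\<sigma> m) = \<pi>}"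
        using that assms(1) by (intro cocc_eq_card_win) (auto simp: perms_def)
      also have "{i. i + k \<le> length (\<sigma> m) \<and> win k i (\<sigma> m) = \<pi>} = {i. i < length (?es m) \<and> \<pi> = ?es m ! i}"
      proof -
        have "i + k \<le> length (\<sigma> m) \<longleftrightarrow> i < length (?es m)" for i
          using xs(2)[of m] unfolding \<sigma>_def length_std by linarith
        then show ?thesis using xs(3)[of _ m] by (auto simp: \<sigma>_def win_std simp del: replicate.simps)
      qed
      also have "card \<dots> = count_list (?es m) \<pi>"
        by (simp only: count_list_eq_length_filter length_filter_conv_card)
      finally show ?thesis by (simp only: count_list_concat_replicate)
    qed
    let ?c = "real (length C)" and ?x = "real (count_list C \<pi>)"
    \<comment> \<open>Cancelling \<open>Suc m\<close> turns the k - 1 extra entries into a vanishing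
      term of the denominator.\<close>
    have "cocc_prop \<pi> (\<sigma> m) = ?x / (?c + real (k - 1) * inverse (real (Suc m)))" for m
    proof -
      have "length (\<sigma> m) = Suc m * length C + (k - 1)" using len[of m] assms(1) by simp
      then have "real (length (\<sigma> m)) = real (Suc m) * (?c + real (k - 1) * inverse (real (Suc m)))"
        by (simp add: distrib_left del: of_nat_Suc mult_Suc)
      then show ?thesis unfolding cocc_prop_def cocc of_nat_mult by (simp del: of_nat_Suc)
    qed
    moreover have "(\<lambda>m. ?x / (?c + real (k - 1) * inverse (real (Suc m)))) \<longlonglongrightarrow> ?x / (?c + real (k - 1) * 0)"
      using \<open>C \<noteq> []\<close> by (intro tendsto_intros LIMSEQ_inverse_real_of_nat) simp
    ultimately show ?thesis by (simp add: cycle_vec_def)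
  qed
  moreover have "cycle_vec C \<in> cube k"
    using C_sub \<open>C \<noteq> []\<close> count_le_length[of C]
    by (auto simp: cube_def cycle_vec_def divide_le_eq count_list_0_iff)
  ultimately show ?thesis
    unfolding feasible_def by blast
qed

section \<open>Convexity\<close>

text \<open>Common form of the direct and the skew sum: translating a block does not change its
  patterns, so one argument treats both. That the result lies in the class is always a separate
  closure hypothesis.\<close>

definition juxtaposition :: "(nat list \<Rightarrow> nat list \<Rightarrow> nat list) \<Rightarrow> bool" where
  "juxtaposition f \<longleftrightarrow> (\<forall>\<sigma> \<rho>. \<exists>a b. f \<sigma> \<rho> = map (\<lambda>x. x + a) \<sigma> @ map (\<lambda>x. x + b) \<rho>)"

lemma juxtaposition_dsum: "juxtaposition dsum"
  unfolding juxtaposition_def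
proof (intro allI)
  show "\<exists>a b. dsum \<sigma> \<rho> = map (\<lambda>x. x + a) \<sigma> @ map (\<lambda>x. x + b) \<rho>" for \<sigma> \<rho>
    by (intro exI[of _ 0] exI[of _ "length \<sigma>"]) (simp add: dsum_def)
qed

lemma juxtaposition_ssum: "juxtaposition ssum"
  unfolding juxtaposition_def
proof (intro allI)
  show "\<exists>a b. ssum \<sigma> \<rho> = map (\<lambda>x. x + a) \<sigma> @ map (\<lambda>x. x + b) \<rho>" for \<sigma> \<rho>
    by (intro exI[of _ "length \<rho>"] exI[of _ 0]) (simp add: ssum_def)
qed

lemma juxtaposition_windows:
  assumes "juxtaposition f"
  shows "length (f \<sigma> \<rho>) = length \<sigma> + length \<rho>"
    and "i + k \<le> length \<sigma> \<Longrightarrow> win k i (f \<sigma> \<rho>) = win k i \<sigma>"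
    and "win k (length \<sigma> + i) (f \<sigma> \<rho>) = win k i \<rho>"
proof -
  obtain a b where f: "f \<sigma> \<rho> = map (\<lambda>x. x + a) \<sigma> @ map (\<lambda>x. x + b) \<rho>"
    using assms unfolding juxtaposition_def by blast
  show "length (f \<sigma> \<rho>) = length \<sigma> + length \<rho>" by (simp add: f)
  show "win k i (f \<sigma> \<rho>) = win k i \<sigma>" if "i + k \<le> length \<sigma>"
    using that by (simp add: f win_def take_map drop_map)
  show "win k (length \<sigma> + i) (f \<sigma> \<rho>) = win k i \<rho>"
    by (simp add: f win_def take_map drop_map)
qed

lemma cocc_juxtaposition:
  assumes f: "juxtaposition f" and \<pi>: "length \<pi> = k" "k \<ge> 1"
  shows "cocc \<pi> \<sigma> + cocc \<pi> \<rho> \<le> cocc \<pi> (f \<sigma> \<rho>)" "cocc \<pi> (f \<sigma> \<rho>) \<le> cocc \<pi> \<sigma> + cocc \<pi> \<rho> + k"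
proof -
  note [simp] = juxtaposition_windows(1,3)[OF f] cocc_eq_card_win[OF \<pi>]
  let ?n = "length \<sigma>"
  let ?A = "{i. i + k \<le> ?n \<and> win k i \<sigma> = \<pi>}" and ?B = "{i. i + k \<le> length \<rho> \<and> win k i \<rho> = \<pi>}"
  let ?M = "{i. i + k \<le> ?n + length \<rho> \<and> win k i (f \<sigma> \<rho>) = \<pi>}"
  have finA: "finite ?A" by (rule finite_subset[of _ "{..?n}"]) auto
  have finB: "finite ?B" by (rule finite_subset[of _ "{..length \<rho>}"]) auto
  have finM: "finite ?M" by (rule finite_subset[of _ "{..?n + length \<rho>}"]) auto
  have "?A \<inter> (+) ?n ` ?B = {}" using \<pi>(2) by auto
  then have card: "card (?A \<union> (+) ?n ` ?B) = card ?A + card ?B"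
    using finA finB by (simp add: card_Un_disjoint card_image)
  have "?A \<union> (+) ?n ` ?B \<subseteq> ?M" by (auto simp: juxtaposition_windows(2)[OF f])
  from card_mono[OF finM this] card show "cocc \<pi> \<sigma> + cocc \<pi> \<rho> \<le> cocc \<pi> (f \<sigma> \<rho>)" by simp
  \<comment> \<open>Any window meeting both blocks starts among the last k positions of the first
    block.\<close>
  have "?M \<subseteq> (?A \<union> (+) ?n ` ?B) \<union> {?n - k..<?n}"
  proof
    fix i assume i: "i \<in> ?M"
    consider "i + k \<le> ?n" | "?n - k \<le> i" "i < ?n" | "?n \<le> i" by linarith
    then show "i \<in> (?A \<union> (+) ?n ` ?B) \<union> {?n - k..<?n}"
    proof cases
      case 1
      then show ?thesis using i by (simp add: juxtaposition_windows(2)[OF f])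
    next
      case 2
      then show ?thesis by simp
    next
      case 3
      then obtain j where "i = ?n + j" using le_Suc_ex by blast
      then show ?thesis using i by auto
    qed
  qed
  then have "card ?M \<le> card ((?A \<union> (+) ?n ` ?B) \<union> {?n - k..<?n})"
    using finA finB by (intro card_mono) auto
  also have "\<dots> \<le> card (?A \<union> (+) ?n ` ?B) + card {?n - k..<?n}" by (rule card_Un_le)
  finally show "cocc \<pi> (f \<sigma> \<rho>) \<le> cocc \<pi> \<sigma> + cocc \<pi> \<rho> + k" using card by simp
qed

text \<open>The error depends on the number of summands and not on their lengths, so long summands
  make it small relative to the total length.\<close>

lemma cocc_juxtaposition_list:
  assumes f: "juxtaposition f" and cl: "\<And>\<sigma> \<rho>. \<sigma> \<in> S \<Longrightarrow> \<rho> \<in> S \<Longrightarrow> f \<sigma> \<rho> \<in> S" and "k \<ge> 1"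
    and "L \<noteq> []" "set L \<subseteq> S"
  shows "\<exists>\<tau>\<in>S. length \<tau> = sum_list (map length L) \<and> (\<forall>\<pi>. length \<pi> = k \<longrightarrow>
    sum_list (map (cocc \<pi>) L) \<le> cocc \<pi> \<tau> \<and> cocc \<pi> \<tau> \<le> sum_list (map (cocc \<pi>) L) + k * length L)"
  using assms(4,5)
proof (induction L rule: list_nonempty_induct)
  case (single \<sigma>)
  then show ?case by auto
next
  case (cons \<sigma> L)
  then obtain \<tau> where \<tau>: "\<tau> \<in> S" "length \<tau> = sum_list (map length L)"
    "\<And>\<pi>. length \<pi> = k \<Longrightarrow> sum_list (map (cocc \<pi>) L) \<le> cocc \<pi> \<tau> \<and> cocc \<pi> \<tau> \<le> sum_list (map (cocc \<pi>) L) + k * length L"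
    by auto
  have "f \<sigma> \<tau> \<in> S" using cons \<tau>(1) cl by simp
  moreover have "sum_list (map (cocc \<pi>) (\<sigma> # L)) \<le> cocc \<pi> (f \<sigma> \<tau>)
    \<and> cocc \<pi> (f \<sigma> \<tau>) \<le> sum_list (map (cocc \<pi>) (\<sigma> # L)) + k * length (\<sigma> # L)" if "length \<pi> = k" for \<pi>
    using cocc_juxtaposition[OF f that assms(3), of \<sigma> \<tau>] \<tau>(3)[OF that] by simp
  ultimately show ?case
    using \<tau>(2) juxtaposition_windows(1)[OF f] by (intro bexI[of _ "f \<sigma> \<tau>"]) auto
qed

lemma rational_approx_unit_interval:
  fixes u \<epsilon> :: real
  assumes "0 \<le> u" "u \<le> 1" "\<epsilon> > 0"
  obtains p q :: nat where "q > 0" "p \<le> q" "\<bar>real p / real q - u\<bar> < \<epsilon>"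
proof -
  obtain q where q: "q > 0" "inverse (real q) < \<epsilon>" using ex_inverse_of_nat_less[OF assms(3)] by blast
  define p where "p = nat \<lfloor>u * q\<rfloor>"
  have "real p = of_int \<lfloor>u * q\<rfloor>" using assms by (simp add: p_def)
  then have p: "real p \<le> u * q" "u * q < real p + 1" by linarith+
  have "u * real q \<le> 1 * real q" using assms by (intro mult_right_mono) auto
  then have "p \<le> q" using p by linarith
  moreover have "\<bar>real p / real q - u\<bar> \<le> inverse (real q)"
  proof -
    have "real p / q \<le> u" "u < (real p + 1) / q"
      using p q by (simp_all add: divide_le_eq less_divide_eq)
    then show ?thesis by (simp add: add_divide_distrib inverse_eq_divide)
  qed
  ultimately show ?thesis using that q by force
qed

text \<open>Three errors of \<open>\<epsilon> / 3\<close> are added: occurrences across seams,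
  approximation of \<open>x\<close> and \<open>y\<close> by single permutations, and replacement of
  the weight \<open>u\<close> by a rational \<open>s\<close>.\<close>

lemma convex_feasible:
  assumes f: "juxtaposition f" and cl: "\<And>\<sigma> \<rho>. \<sigma> \<in> Av B \<Longrightarrow> \<rho> \<in> Av B \<Longrightarrow> f \<sigma> \<rho> \<in> Av B" and k: "k \<ge> 1"
  shows "convex (feasible k B)"
proof (rule convexI)
  fix x y and u w :: real
  assume x: "x \<in> feasible k B" and y: "y \<in> feasible k B" and uw: "0 \<le> u" "0 \<le> w" "u + w = 1"
  have cube: "x \<in> cube k" "y \<in> cube k" using x y by (auto simp: feasible_def)
  have w: "w = 1 - u" using uw by simp
  have z: "(u *\<^sub>R x + w *\<^sub>R y) \<pi> = u * x \<pi> + (1 - u) * y \<pi>" for \<pi>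
    by (simp add: scaleR_fun_def w)
  have "u *\<^sub>R x + w *\<^sub>R y \<in> cube k"
    unfolding cube_def
  proof (intro CollectI conjI ballI allI impI)
    fix \<pi> assume "\<pi> \<in> perms k"
    then have "0 \<le> x \<pi>" "x \<pi> \<le> 1" "0 \<le> y \<pi>" "y \<pi> \<le> 1" using cube by (auto simp: cube_def)
    then show "0 \<le> (u *\<^sub>R x + w *\<^sub>R y) \<pi>" "(u *\<^sub>R x + w *\<^sub>R y) \<pi> \<le> 1"
      unfolding z using uw w convex_bound_le[of "x \<pi>" 1 "y \<pi>" u "1 - u"] by auto
  next
    fix \<pi> assume "\<pi> \<notin> perms k"
    then show "(u *\<^sub>R x + w *\<^sub>R y) \<pi> = 0" using cube unfolding z by (simp add: cube_def)
  qed
  moreover have "\<exists>\<tau>\<in>Av B. N \<le> length \<tau> \<and> (\<forall>\<pi>\<in>perms k. \<bar>cocc_prop \<pi> \<tau> - (u *\<^sub>R x + w *\<^sub>R y) \<pi>\<bar> < \<epsilon>)"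
    if eps: "\<epsilon> > 0" for \<epsilon> N
  proof -
    have eps3: "\<epsilon> / 3 > 0" using eps by simp
    obtain p q :: nat where pq: "q > 0" "p \<le> q" "\<bar>real p / real q - u\<bar> < \<epsilon> / 3"
      by (rule rational_approx_unit_interval[of u "\<epsilon> / 3"]) (use uw eps in auto)
    define s where "s = real p / real q"
    have s: "0 \<le> s" "s \<le> 1" "\<bar>s - u\<bar> < \<epsilon> / 3" using pq by (auto simp: s_def)
    \<comment> \<open>Summands of length at least \<open>M\<close> keep the seam error of k per
      summand below \<open>\<epsilon> / 3\<close> of the length.\<close>
    obtain M where M: "real k / (\<epsilon> / 3) < real M" using reals_Archimedean2 by blast
    define M' where "M' = max (max N M) 1"
    obtain \<sigma> where \<sigma>: "\<sigma> \<in> Av B" "M' \<le> length \<sigma>" "\<forall>\<pi>\<in>perms k. \<bar>cocc_prop \<pi> \<sigma> - x \<pi>\<bar> < \<epsilon> / 3"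
      using x eps3 unfolding feasible_iff by blast
    obtain \<rho> where \<rho>: "\<rho> \<in> Av B" "M' \<le> length \<rho>" "\<forall>\<pi>\<in>perms k. \<bar>cocc_prop \<pi> \<rho> - y \<pi>\<bar> < \<epsilon> / 3"
      using y eps3 unfolding feasible_iff by blast
    let ?m = "length \<sigma>" and ?n = "length \<rho>"
    have mn: "?m > 0" "?n > 0" "N \<le> ?m" "N \<le> ?n" "M \<le> ?m" "M \<le> ?n"
      using \<sigma>(2) \<rho>(2) by (auto simp: M'_def)
    \<comment> \<open>The two blocks get lengths in the ratio p : (q - p), whatever the lengths of the summands.\<close>
    define L where "L = replicate (p * ?n) \<sigma> @ replicate ((q - p) * ?m) \<rho>"
    have "L \<noteq> []" using pq mn by (auto simp: L_def)
    moreover have "set L \<subseteq> Av B" using \<sigma> \<rho> by (auto simp: L_def)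
    ultimately obtain \<tau> where \<tau>: "\<tau> \<in> Av B" "length \<tau> = sum_list (map length L)"
      "\<And>\<pi>. length \<pi> = k \<Longrightarrow> sum_list (map (cocc \<pi>) L) \<le> cocc \<pi> \<tau> \<and> cocc \<pi> \<tau> \<le> sum_list (map (cocc \<pi>) L) + k * length L"
      using cocc_juxtaposition_list[OF f cl k, of L] by blast
    have pqq: "real (q - p) = real q - real p" using pq by (simp add: of_nat_diff)
    obtain r where r: "q = p + r" using pq(2) le_Suc_ex by blast
    have len_nat: "length \<tau> = q * ?m * ?n"
      unfolding \<tau>(2) L_def r by (simp add: sum_list_replicate algebra_simps)
    then have len: "real (length \<tau>) = real q * ?m * ?n" by simp
    have "1 * N * 1 \<le> q * ?m * ?n" using pq(1) mn(2,3) by (intro mult_le_mono) linarith+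
    then have lenN: "N \<le> length \<tau>" using len_nat by linarith
    \<comment> \<open>Used with occurrence counts for \<open>a\<close> and \<open>b\<close> to find
      the main term \<open>c\<close>, and with \<open>a = b = k\<close> to bound the seam
      error.\<close>
    have weights: "(real p * ?n * a + (real q - real p) * ?m * b) / (real q * ?m * ?n)
      = s * (a / ?m) + (1 - s) * (b / ?n)" for a b :: real
    proof -
      have "real q \<noteq> 0" "real ?m \<noteq> 0" "real ?n \<noteq> 0" using pq(1) mn(1,2) by auto
      then show ?thesis unfolding s_def by (simp add: divide_simps)
    qed
    have kM: "real k < ?m * (\<epsilon> / 3)" "real k < ?n * (\<epsilon> / 3)"
    proof -
      have "\<epsilon> / 3 > 0" using eps by simp
      then have "real k < M * (\<epsilon> / 3)" using M by (simp only: pos_divide_less_eq)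
      moreover have "M * (\<epsilon> / 3) \<le> ?m * (\<epsilon> / 3)" "M * (\<epsilon> / 3) \<le> ?n * (\<epsilon> / 3)"
        using mn(5,6) \<open>\<epsilon> / 3 > 0\<close> by (intro mult_right_mono; linarith)+
      ultimately show "real k < ?m * (\<epsilon> / 3)" "real k < ?n * (\<epsilon> / 3)" by linarith+
    qed
    have "\<bar>cocc_prop \<pi> \<tau> - (u *\<^sub>R x + w *\<^sub>R y) \<pi>\<bar> < \<epsilon>" if \<pi>: "\<pi> \<in> perms k" for \<pi>
    proof -
      define c where "c = s * cocc_prop \<pi> \<sigma> + (1 - s) * cocc_prop \<pi> \<rho>"
      have pos: "real q * ?m * ?n > 0" using pq mn by simp
      have sumL: "real (sum_list (map (cocc \<pi>) L)) / (real q * ?m * ?n) = c"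
        unfolding c_def cocc_prop_def weights[symmetric] by (simp add: L_def sum_list_replicate pqq)
      have lenL: "real k * real (length L) / (real q * ?m * ?n) = s * (k / ?m) + (1 - s) * (k / ?n)"
        unfolding weights[symmetric] by (simp add: L_def pqq algebra_simps(17,18))
      have "length \<pi> = k" using \<pi> by (simp add: perms_def)
      from \<tau>(3)[OF this] have "real (sum_list (map (cocc \<pi>) L)) \<le> cocc \<pi> \<tau>"
        "real (cocc \<pi> \<tau>) \<le> real (sum_list (map (cocc \<pi>) L)) + real k * real (length L)"
        by (simp_all flip: of_nat_mult of_nat_add)
      then have "c \<le> cocc_prop \<pi> \<tau>" "cocc_prop \<pi> \<tau> \<le> c + (s * (k / ?m) + (1 - s) * (k / ?n))"
        unfolding cocc_prop_def len sumL[symmetric] lenL[symmetric] add_divide_distrib[symmetric]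
        using divide_right_mono[OF _ less_imp_le[OF pos]] by blast+
      moreover have "s * (k / ?m) + (1 - s) * (k / ?n) \<le> \<epsilon> / 3"
      proof (rule convex_bound_le)
        show "k / ?m \<le> \<epsilon> / 3" using kM(1) mn(1) by (subst pos_divide_le_eq) (simp_all add: mult.commute)
        show "k / ?n \<le> \<epsilon> / 3" using kM(2) mn(2) by (subst pos_divide_le_eq) (simp_all add: mult.commute)
      qed (use s(1,2) in auto)
      ultimately have 1: "\<bar>cocc_prop \<pi> \<tau> - c\<bar> \<le> \<epsilon> / 3" by linarith
      have "c - (s * x \<pi> + (1 - s) * y \<pi>) = s * (cocc_prop \<pi> \<sigma> - x \<pi>) + (1 - s) * (cocc_prop \<pi> \<rho> - y \<pi>)"
        by (simp add: c_def algebra_simps)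
      moreover have "\<bar>s * (cocc_prop \<pi> \<sigma> - x \<pi>) + (1 - s) * (cocc_prop \<pi> \<rho> - y \<pi>)\<bar>
        \<le> s * \<bar>cocc_prop \<pi> \<sigma> - x \<pi>\<bar> + (1 - s) * \<bar>cocc_prop \<pi> \<rho> - y \<pi>\<bar>"
        using s(1,2) by (intro order_trans[OF abs_triangle_ineq]) (simp add: abs_mult)
      moreover have "s * \<bar>cocc_prop \<pi> \<sigma> - x \<pi>\<bar> + (1 - s) * \<bar>cocc_prop \<pi> \<rho> - y \<pi>\<bar> < \<epsilon> / 3"
        by (rule convex_bound_lt) (use s(1,2) \<sigma>(3) \<rho>(3) \<pi> in auto)
      ultimately have 2: "\<bar>c - (s * x \<pi> + (1 - s) * y \<pi>)\<bar> < \<epsilon> / 3" by linarith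
      have "0 \<le> x \<pi>" "x \<pi> \<le> 1" "0 \<le> y \<pi>" "y \<pi> \<le> 1" using cube \<pi> by (auto simp: cube_def)
      then have "\<bar>x \<pi> - y \<pi>\<bar> \<le> 1" by linarith
      then have "\<bar>s - u\<bar> * \<bar>x \<pi> - y \<pi>\<bar> \<le> \<bar>s - u\<bar>" by (rule mult_left_le) simp
      moreover have "(s * x \<pi> + (1 - s) * y \<pi>) - (u * x \<pi> + (1 - u) * y \<pi>) = (s - u) * (x \<pi> - y \<pi>)"
        by (simp add: algebra_simps)
      ultimately have "\<bar>(s * x \<pi> + (1 - s) * y \<pi>) - (u * x \<pi> + (1 - u) * y \<pi>)\<bar> < \<epsilon> / 3"
        using s(3) unfolding abs_mult[symmetric] by simp
      with 1 2 show ?thesis unfolding z by linarith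
    qed
    then show ?thesis using \<tau>(1) lenN by blast
  qed
  ultimately show "u *\<^sub>R x + w *\<^sub>R y \<in> feasible k B"
    unfolding feasible_iff by blast
qed

section \<open>Direct and skew sums as permutations\<close>

lemma dsum_perms: "\<sigma> \<in> perms m \<Longrightarrow> \<rho> \<in> perms n \<Longrightarrow> dsum \<sigma> \<rho> \<in> perms (m + n)"
proof -
  assume *: "\<sigma> \<in> perms m" "\<rho> \<in> perms n"
  have "(\<lambda>x. x + m) ` {1..n} = {m + 1..m + n}"
    using image_add_atLeastAtMost'[of m 1 n] by (simp add: add.commute)
  then have "set (dsum \<sigma> \<rho>) = {1..m + n}"
    using * by (auto simp: dsum_def perms_def)
  moreover from this have "distinct (dsum \<sigma> \<rho>)"
    using * by (intro card_distinct) (simp add: dsum_def perms_def)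
  ultimately show ?thesis using * by (simp add: perms_def dsum_def)
qed

lemma ssum_perms: "\<sigma> \<in> perms m \<Longrightarrow> \<rho> \<in> perms n \<Longrightarrow> ssum \<sigma> \<rho> \<in> perms (m + n)"
proof -
  assume *: "\<sigma> \<in> perms m" "\<rho> \<in> perms n"
  have "(\<lambda>x. x + n) ` {1..m} = {n + 1..n + m}"
    using image_add_atLeastAtMost'[of n 1 m] by (simp add: add.commute)
  then have "set (ssum \<sigma> \<rho>) = {1..m + n}"
    using * by (auto simp: ssum_def perms_def)
  moreover from this have "distinct (ssum \<sigma> \<rho>)"
    using * by (intro card_distinct) (simp add: ssum_def perms_def)
  ultimately show ?thesis using * by (simp add: perms_def ssum_def)
qed

lemma Av_perms: "\<sigma> \<in> Av B \<Longrightarrow> \<sigma> \<in> perms (length \<sigma>) \<and> \<sigma> \<noteq> []"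
  using Av_iff Av_nD by blast

lemma Av_notin_contains:
  assumes "\<sigma> \<in> perms n" "n > 0" "\<sigma> \<notin> Av {\<tau>}"
  shows "contains \<sigma> \<tau>"
  using assms unfolding Av_iff by (auto simp: Av_n_def perms_def)

lemma Av_not_contains: "\<sigma> \<in> Av {\<tau>} \<Longrightarrow> \<not> contains \<sigma> \<tau>"
  by (auto simp: Av_def Av_n_def)

text \<open>All permutations together are closed under direct sums, so the unrestricted region is
  convex and only the generators of the hull need checking. A cycle of the overlap graph of the
  class is also a cycle of the full overlap graph.\<close>

lemma overlap_polytope_subset_feasible:
  assumes "k \<ge> 1"
  shows "overlap_polytope k B \<subseteq> feasible k {}"
  unfolding overlap_polytope_def cycle_polytope_def
proof (rule hull_minimal)
  have "dsum \<sigma> \<rho> \<in> Av {}" if *: "\<sigma> \<in> Av {}" "\<rho> \<in> Av {}" for \<sigma> \<rho>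
  proof -
    have "dsum \<sigma> \<rho> \<in> perms (length \<sigma> + length \<rho>)" "\<sigma> \<noteq> []"
      using Av_perms[OF *(1)] Av_perms[OF *(2)] dsum_perms by auto
    then show ?thesis
      unfolding Av_empty all_perms_def by (auto intro!: bexI[of _ "length \<sigma> + length \<rho>"] simp: Suc_le_eq)
  qed
  then show "convex (feasible k {})"
    using convex_feasible[OF juxtaposition_dsum _ assms] by blast
  show "{cycle_vec C |C. simple_cycle (Av_n k B) (\<lambda>\<pi>. pat {1..k - 1} \<pi>) (\<lambda>\<pi>. pat {2..k} \<pi>) C} \<subseteq> feasible k {}"
  proof safe
    fix C assume "simple_cycle (Av_n k B) (\<lambda>\<pi>. pat {1..k - 1} \<pi>) (\<lambda>\<pi>. pat {2..k} \<pi>) C"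
    then have C: "cycle (Av_n k B) (\<lambda>\<pi>. pat {1..k - 1} \<pi>) (\<lambda>\<pi>. pat {2..k} \<pi>) C"
      by (simp add: simple_cycle_def)
    then have C_sub: "set C \<subseteq> Av_n k B" and C_ne: "C \<noteq> []" by (auto simp: cycle_def walk_def)
    have ends: "pat {1..k - 1} \<pi> = win (k - 1) 0 \<pi>" "pat {2..k} \<pi> = win (k - 1) 1 \<pi>" if "\<pi> \<in> set C" for \<pi>
      using overlap_ends[of \<pi> k B] C_sub assms that by auto
    have "cycle (perms k) (\<lambda>\<pi>. win (k - 1) 0 \<pi>) (\<lambda>\<pi>. win (k - 1) 1 \<pi>) C"
      unfolding cycle_def walk_def
    proof (intro conjI allI impI C_ne)
      show "set C \<subseteq> perms k" using C_sub by (auto simp: Av_n_def)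
      show "win (k - 1) 0 (hd C) = win (k - 1) 1 (last C)"
        using C C_ne ends[of "hd C"] ends[of "last C"] by (simp add: cycle_def)
      fix i assume "Suc i < length C"
      then show "win (k - 1) 1 (C ! i) = win (k - 1) 0 (C ! Suc i)"
        using C ends[of "C ! i"] ends[of "C ! Suc i"] by (simp add: cycle_def walk_def)
    qed
    with assms show "cycle_vec C \<in> feasible k {}" by (rule cycle_vec_feasible)
  qed
qed

section \<open>Dimension of the feasible region\<close>

text \<open>Sliding a window along a member of the class traces a walk, so a member that begins with
  one vertex and ends with another connects the two.\<close>

lemma windows_connected:
  assumes \<sigma>: "\<sigma> \<in> Av_n n B" and "k \<ge> 1" "i + d + (k - 1) \<le> n"
  shows "(win (k - 1) i \<sigma>, win (k - 1) (i + d) \<sigma>)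
    \<in> {(pat {1..k - 1} \<pi>, pat {2..k} \<pi>) | \<pi>. \<pi> \<in> Av_n k B}\<^sup>*"
  using assms(3)
proof (induction d)
  case (Suc d)
  let ?e = "win k (i + d) \<sigma>"
  have e: "?e \<in> Av_n k B" using \<sigma> Suc.prems assms(2) by (intro win_in_Av_n) auto
  have "pat {1..k - 1} ?e = win (k - 1) (i + d) \<sigma>" "pat {2..k} ?e = win (k - 1) (i + Suc d) \<sigma>"
    using overlap_ends[OF e assms(2)] assms(2) by (simp_all add: win_win)
  then have step: "(win (k - 1) (i + d) \<sigma>, win (k - 1) (i + Suc d) \<sigma>)
      \<in> {(pat {1..k - 1} \<pi>, pat {2..k} \<pi>) | \<pi>. \<pi> \<in> Av_n k B}"
    using e by (intro CollectI exI[of _ ?e]) simp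
  have "i + d + (k - 1) \<le> n" using Suc.prems by simp
  from rtrancl_into_rtrancl[OF Suc.IH[OF this] step] show ?case .
qed simp

lemma affine_flow: "affine {v. flow E st ar v \<and> sum v E = 1}"
  unfolding affine_def
proof (intro ballI allI impI)
  fix x y and u w :: real
  assume *: "x \<in> {v. flow E st ar v \<and> sum v E = 1}" "y \<in> {v. flow E st ar v \<and> sum v E = 1}" "u + w = 1"
  have "u *\<^sub>R x + w *\<^sub>R y = (\<lambda>e. u * x e + w * y e)"
    by (simp add: fun_eq_iff scaleR_fun_def)
  moreover have "flow E st ar (\<lambda>e. u * x e + w * y e)"
    using * by (intro flow_lincomb) auto
  moreover have "(\<Sum>e\<in>E. u * x e + w * y e) = 1"
    using * by (simp add: sum.distrib flip: sum_distrib_left)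
  ultimately show "u *\<^sub>R x + w *\<^sub>R y \<in> {v. flow E st ar v \<and> sum v E = 1}"
    by simp
qed

text \<open>Differences of points of the affine hull are circulations of mass 0, to which the linear
  bound applies. For k = 1 without edges, the empty permutation may be a vertex that nothing leaves;
  that case is split off, the region then being empty and hence of dimension -1.\<close>

lemma affine_dim_feasible_le:
  assumes f: "juxtaposition f" and cl: "\<And>\<sigma> \<rho>. \<sigma> \<in> Av B \<Longrightarrow> \<rho> \<in> Av B \<Longrightarrow> f \<sigma> \<rho> \<in> Av B" and k: "k \<ge> 1"
  shows "affine_dim (feasible k B) \<le> int (card (Av_n k B)) - int (card (Av_n (k - 1) B))"
proof (cases "k = 1 \<and> Av_n k B = {}")
  case True
  then have "feasible k B = {}" using feasible_flow(3)[OF _ k] by fastforce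
  moreover have "card (Av_n (k - 1) B) \<le> 1"
  proof -
    have "Av_n (k - 1) B \<subseteq> {[]}" using True by (auto simp: Av_n_def perms_def)
    from card_mono[OF _ this] show ?thesis by simp
  qed
  ultimately show ?thesis using True by (simp add: affine_dim_def)
next
  case False
  let ?E = "Av_n k B" and ?V = "Av_n (k - 1) B"
  let ?st = "\<lambda>\<pi>. pat {1..k - 1} \<pi>" and ?ar = "\<lambda>\<pi>. pat {2..k} \<pi>"
  let ?F = "{v. flow ?E ?st ?ar v \<and> sum v ?E = 1}"
  define D where "D = {x - y | x y. x \<in> affine hull feasible k B \<and> y \<in> affine hull feasible k B}"
  have hull: "affine hull feasible k B \<subseteq> ?F"
    using feasible_flow[OF _ k] affine_flow by (intro hull_minimal) auto
  have D: "D \<subseteq> {d. flow ?E ?st ?ar d \<and> sum d ?E = 0}"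
  proof
    fix d assume "d \<in> D"
    then obtain x y where xy: "d = x - y" "x \<in> ?F" "y \<in> ?F" using hull unfolding D_def by blast
    have "d = (\<lambda>e. 1 * x e + (-1) * y e)" by (simp add: xy fun_eq_iff)
    moreover have "flow ?E ?st ?ar (\<lambda>e. 1 * x e + (-1) * y e)"
      using xy by (intro flow_lincomb) auto
    ultimately show "d \<in> {d. flow ?E ?st ?ar d \<and> sum d ?E = 0}"
      using xy by (simp add: sum_subtractf)
  qed
  have ends: "?st \<pi> \<in> ?V \<and> ?ar \<pi> \<in> ?V" if "\<pi> \<in> ?E" for \<pi>
    using overlap_ends[OF that k] win_in_Av_n[OF that, of 0 "k - 1"] win_in_Av_n[OF that, of 1 "k - 1"] k by simp
  \<comment> \<open>For k = 1 a vertex would be the empty permutation, which \<open>Av\<close>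
    leaves out, so closure under \<open>f\<close> says nothing about it.\<close>
  have join: "f x y \<in> Av_n (2 * (k - 1)) B \<and> win (k - 1) 0 (f x y) = x \<and> win (k - 1) (k - 1) (f x y) = y"
    if xy: "x \<in> ?V" "y \<in> ?V" and "k \<noteq> 1" for x y
  proof -
    have len: "length x = k - 1" "length y = k - 1" using Av_nD xy by auto
    then have "f x y \<in> Av B" using xy \<open>k \<noteq> 1\<close> k by (intro cl) (auto simp: Av_iff)
    then have "f x y \<in> Av_n (length (f x y)) B" by (simp add: Av_iff)
    then have "f x y \<in> Av_n (2 * (k - 1)) B"
      using len by (simp add: juxtaposition_windows(1)[OF f] mult_2)
    moreover have "win (k - 1) 0 x = x" "win (k - 1) 0 y = y"
      using Av_nD[OF xy(1)] Av_nD[OF xy(2)] std_perms[of x "k - 1"] std_perms[of y "k - 1"] by (simp_all add: win_def)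
    ultimately show ?thesis
      using juxtaposition_windows(2)[OF f, of 0 "k - 1" x y] juxtaposition_windows(3)[OF f, of "k - 1" x 0 y] len
      by simp
  qed
  have "\<exists>e\<in>?E. ?st e = x" if x: "x \<in> ?V" for x
  proof (cases "k = 1")
    case True
    then obtain e where "e \<in> ?E" using False by blast
    moreover have "?st e = x" using ends[OF \<open>e \<in> ?E\<close>] x True by (simp add: Av_n_def perms_def)
    ultimately show ?thesis by blast
  next
    case False
    \<comment> \<open>The first k entries of \<open>f x x\<close> give an edge leaving
      \<open>x\<close>; they exist because k is at most 2 (k - 1) once k is at least 2.\<close>
    with join[OF x x] have j: "f x x \<in> Av_n (2 * (k - 1)) B" "win (k - 1) 0 (f x x) = x" by auto
    from win_in_Av_n[OF j(1), of 0 k] have e: "win k 0 (f x x) \<in> ?E" using False k by simp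
    moreover have "?st (win k 0 (f x x)) = x"
      using overlap_ends(1)[OF e k] j(2) by (simp add: win_win)
    ultimately show ?thesis by blast
  qed
  moreover have "(x, y) \<in> {(?st e, ?ar e) | e. e \<in> ?E}\<^sup>*" if xy: "x \<in> ?V" "y \<in> ?V" for x y
  proof (cases "k = 1")
    case True
    then show ?thesis using xy by (simp add: Av_n_def perms_def)
  next
    case False
    with join[OF xy] have "f x y \<in> Av_n (2 * (k - 1)) B" "win (k - 1) 0 (f x y) = x" "win (k - 1) (k - 1) (f x y) = y"
      by auto
    with windows_connected[of "f x y" "2 * (k - 1)" B k 0 "k - 1"] k show ?thesis by simp
  qed
  ultimately have "card ?V \<le> card ?E" "dim D \<le> card ?E - card ?V"
    using dim_flow_le[OF finite_Av_n finite_Av_n ends _ _ D] by blast+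
  \<comment> \<open>The inequality \<open>card ?V \<le> card ?E\<close> makes the natural
    subtraction exact and also settles an empty region, whose dimension is -1.\<close>
  then show ?thesis
    unfolding affine_dim_def D_def[symmetric] by (auto simp: of_nat_diff)
qed

section \<open>Classes avoiding one pattern\<close>

lemma subseq_shift:
  assumes "subseq ys (map (\<lambda>x. x + a) \<sigma>)"
  shows "contains \<sigma> (std ys)" and "set ys \<subseteq> (\<lambda>x. x + a) ` set \<sigma>"
proof -
  obtain N where N: "ys = map (\<lambda>x. x + a) (nths \<sigma> N)"
    using assms by (auto simp: subseq_conv_nths nths_map)
  then show "contains \<sigma> (std ys)"
    unfolding contains_iff_subseq by (metis std_map_add subseq_conv_nths)
  show "set ys \<subseteq> (\<lambda>x. x + a) ` set \<sigma>"
    using N set_nths_subset[of \<sigma> N] by auto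
qed

text \<open>An occurrence that uses both blocks has its first entry in the left block and its last
  entry in the right one. Both comparisons are recorded: direct sums need the first, skew sums the
  second.\<close>

lemma occurrence_across_sum:
  assumes "contains (map (\<lambda>x. x + a) \<sigma> @ map (\<lambda>x. x + b) \<rho>) \<tau>" "\<not> contains \<sigma> \<tau>" "\<not> contains \<rho> \<tau>"
  obtains x y where "x \<in> set \<sigma>" "y \<in> set \<rho>" "hd \<tau> < last \<tau> \<longleftrightarrow> x + a < y + b" "last \<tau> < hd \<tau> \<longleftrightarrow> y + b < x + a"
proof -
  obtain ys where ys: "subseq ys (map (\<lambda>x. x + a) \<sigma> @ map (\<lambda>x. x + b) \<rho>)" "std ys = \<tau>"
    using assms(1) unfolding contains_iff_subseq by blast
  obtain as bs where split: "ys = as @ bs" "subseq as (map (\<lambda>x. x + a) \<sigma>)" "subseq bs (map (\<lambda>x. x + b) \<rho>)"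
    using ys(1) by (rule subseq_appendE)
  \<comment> \<open>If one part were empty, the other would be an occurrence inside a single
    summand.\<close>
  have ne: "as \<noteq> []" "bs \<noteq> []"
    using subseq_shift(1)[OF split(2)] subseq_shift(1)[OF split(3)] assms(2,3) ys(2) split(1) by auto
  then have "hd ys \<in> set as" "last ys \<in> set bs" using split(1) by auto
  then obtain x y where xy: "x \<in> set \<sigma>" "hd ys = x + a" "y \<in> set \<rho>" "last ys = y + b"
    using subseq_shift(2)[OF split(2)] subseq_shift(2)[OF split(3)] by blast
  have "ys \<noteq> []" using ne split(1) by simp
  moreover have "length \<tau> = length ys" using ys(2) length_std by blast
  moreover from calculation have "\<tau> \<noteq> []" by force
  ultimately have "hd \<tau> = std ys ! 0" "last \<tau> = std ys ! (length ys - 1)" "hd ys = ys ! 0" "last ys = ys ! (length ys - 1)"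
    using ys(2) by (simp_all add: hd_conv_nth last_conv_nth)
  then have "hd \<tau> < last \<tau> \<longleftrightarrow> hd ys < last ys" "last \<tau> < hd \<tau> \<longleftrightarrow> last ys < hd ys"
    using \<open>ys \<noteq> []\<close> std_nth_less_iff[of 0 ys "length ys - 1"] std_nth_less_iff[of "length ys - 1" ys 0] by simp_all
  with xy show ?thesis by (intro that[of x y]) simp_all
qed

lemma single_pattern_closed: "closed_dsum {\<tau>} \<or> closed_ssum {\<tau>}"
proof (rule ccontr)
  assume "\<not> ?thesis"
  then obtain \<sigma> \<rho> \<sigma>' \<rho>' where d: "\<sigma> \<in> Av {\<tau>}" "\<rho> \<in> Av {\<tau>}" "dsum \<sigma> \<rho> \<notin> Av {\<tau>}"
    and s: "\<sigma>' \<in> Av {\<tau>}" "\<rho>' \<in> Av {\<tau>}" "ssum \<sigma>' \<rho>' \<notin> Av {\<tau>}"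
    unfolding closed_dsum_def closed_ssum_def by blast
  note p = Av_perms[OF d(1)] Av_perms[OF d(2)] Av_perms[OF s(1)] Av_perms[OF s(2)]
  have "contains (dsum \<sigma> \<rho>) \<tau>"
    using p d(3) by (intro Av_notin_contains[OF dsum_perms]) auto
  then have "contains (map (\<lambda>x. x + 0) \<sigma> @ map (\<lambda>x. x + length \<sigma>) \<rho>) \<tau>"
    by (simp add: dsum_def)
  then obtain x y where "x \<in> set \<sigma>" "y \<in> set \<rho>" "hd \<tau> < last \<tau> \<longleftrightarrow> x + 0 < y + length \<sigma>"
    using occurrence_across_sum Av_not_contains d by metis
  \<comment> \<open>Entries of \<sigma> are at most \<open>length \<sigma>\<close>, and shifted
    entries of \<rho> exceed it.\<close>
  then have "hd \<tau> < last \<tau>" using p by (auto simp: perms_def)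
  have "contains (ssum \<sigma>' \<rho>') \<tau>"
    using p s(3) by (intro Av_notin_contains[OF ssum_perms]) auto
  then have "contains (map (\<lambda>x. x + length \<rho>') \<sigma>' @ map (\<lambda>x. x + 0) \<rho>') \<tau>"
    by (simp add: ssum_def)
  then obtain x y where "x \<in> set \<sigma>'" "y \<in> set \<rho>'" "last \<tau> < hd \<tau> \<longleftrightarrow> y + 0 < x + length \<rho>'"
    using occurrence_across_sum Av_not_contains s by metis
  then have "last \<tau> < hd \<tau>" using p by (auto simp: perms_def)
  with \<open>hd \<tau> < last \<tau>\<close> show False by simp
qed

lemma closed_sum_juxtaposition:
  assumes "closed_dsum B \<or> closed_ssum B"
  obtains f where "juxtaposition f" "\<And>\<sigma> \<rho>. \<sigma> \<in> Av B \<Longrightarrow> \<rho> \<in> Av B \<Longrightarrow> f \<sigma> \<rho> \<in> Av B"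
  using assms juxtaposition_dsum juxtaposition_ssum unfolding closed_dsum_def closed_ssum_def by blast

theorem mainTheorem1:
  fixes k :: nat and B :: "nat list set"
  assumes "k \<ge> 1" and "B \<subseteq> all_perms"
  shows "closed (feasible k B) \<and> feasible k B \<subseteq> cube k
    \<and> feasible k B \<subseteq> overlap_polytope k B
    \<and> overlap_polytope k B \<subseteq> feasible k {}
    \<and> ((closed_dsum B \<or> closed_ssum B) \<longrightarrow>
          convex (feasible k B)
          \<and> affine_dim (feasible k B) \<le> int (card (Av_n k B)) - int (card (Av_n (k - 1) B)))
    \<and> (\<forall>\<tau>\<in>all_perms. convex (feasible k {\<tau>}))"
proof (intro conjI impI ballI)
  show "feasible k B \<subseteq> cube k" by (auto simp: feasible_def)
  show "convex (feasible k B)" if "closed_dsum B \<or> closed_ssum B"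
    using that assms(1) by (metis closed_sum_juxtaposition convex_feasible)
  show "affine_dim (feasible k B) \<le> int (card (Av_n k B)) - int (card (Av_n (k - 1) B))"
    if "closed_dsum B \<or> closed_ssum B"
    using that assms(1) by (metis closed_sum_juxtaposition affine_dim_feasible_le)
  show "convex (feasible k {\<tau>})" for \<tau>
    using single_pattern_closed assms(1) by (metis closed_sum_juxtaposition convex_feasible)
qed (use assms closed_feasible feasible_subset_overlap_polytope overlap_polytope_subset_feasible in blast)+

end
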